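(* For each $\phi\in C_\psi(X)$, the map $t\mapsto F^{\phi_t}$ is a classical solution of the Cauchy problem $$\frac{d}{dt}F_t=LF_t,\qquad F_t|_{t=0}=F_0,$$ with $F_0=F^\phi$. For $n_*<1$, this solution satisfies $F_t(\gamma)\to F_\infty(\gamma)$ as $t\to+\infty$, where $F_\infty(\gamma)\equiv1$ and the convergence holds for all $\gamma\in\Gamma^\psi$.
   Context: Spaces. $X$ is a locally compact Polish space. For a topological space $E$, $C_{\rm b}(E)$ is the set of bounded continuous functions $E\to\mathbb{R}$ (with the supremum norm), and $C_{\rm b}^+(E)$ is the set of its positive (nonnegative) elements. A configuration $\gamma$ is a countable collection of points of $X$, multiple locations allowed, such that each compact subset of $X$ contains only finitely many elements of $\gamma$ (with multiplicity); equivalently, a locally finite counting measure. $\Gamma$ is the set of all configurations with the vague topology (weakest making $\gamma\mapsto\sum_{x\in\gamma}g(x)$ continuous for all compactly supported continuous $g$). Sums and products over $x\in\gamma$ count multiplicities; empty products equal $1$; $\gamma\cup\xi$ and $\gamma\setminus x$ denote adding the particles of $\xi$ and removing one particle located at $x\in\gamma$. $\Gamma_0$ is the set of finite configurations, $|\xi|$ the number of particles of $\xi\in\Gamma_0$, $\Gamma^0$ the singleton consisting of the empty configuration. Tempered configurations. A continuous $\psi:X\to(0,1]$ is fixed which vanishes at infinity (for each $\varepsilon>0$ there is a compact $\Lambda_\varepsilon$ with $\psi<\varepsilon$ off $\Lambda_\varepsilon$) and satisfies $\inf_\Lambda\psi>0$ for each compact $\Lambda$. $\Psi(\gamma)=\sum_{x\in\gamma}\psi(x)$,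 and $\Gamma^\psi=\{\gamma\in\Gamma:\Psi(\gamma)<\infty\}$ is equipped with the weakest topology making all maps $\gamma\mapsto\sum_{x\in\gamma}g(x)\psi(x)$, $g\in C_{\rm b}(X)$, continuous. Branching kernel. $b$ is a probability kernel: each $b_x$, $x\in X$, is a probability measure on $\Gamma$ with $b_x(\Gamma_0)=1$, and $x\mapsto b_x(\Xi)$ is measurable for each Borel $\Xi$. Put $\delta(x)=b_x(\Gamma^0)$, $n(x)=\int_{\Gamma_0}|\xi|\,b_x(d\xi)$, let $\beta^{(1)}_x$ be the measure on $X$ with $\int_\Gamma\big(\sum_{y\in\xi}h(y)\big)b_x(d\xi)=\int_Xh(y)\,\beta^{(1)}_x(dy)$, and $(\Phi\phi)(x)=\int_\Gamma\big(\prod_{y\in\xi}\phi(y)\big)b_x(d\xi)$. Standing assumptions: (i) $\Phi\phi\in C_{\rm b}(X)$ for each $\phi=e^{-g\psi}$ with $g\in C_{\rm b}^+(X)$; (ii) $n_*:=\sup_xn(x)<\infty$; (iii) there is a constant $\delta_*$ with $\delta(x)\ge1-\psi(x)\ge\delta_*>0$ for all $x$; (iv) there is $m>0$ with $\int_X\psi(y)\beta_x^{(1)}(dy)\le n(x)\,m\,\psi(x)$ for all $x$. $C_\psi(X)$ is the set of $\phi\in C_{\rm b}(X)$ for which there is a constant $c_\phi>0$ with $c_\phi\psi(x)\le1-\phi(x)\le1-\delta(x)$ for all $x\in X$. For $\phi\in C_\psi(X)$, $[0,+\infty)\ni t\mapsto\phi_t\in C_\psi(X)$ denotes the unique solution,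 continuously differentiable in $C_{\rm b}(X)$, of $\frac{\partial}{\partial t}\phi_t(x)=-\phi_t(x)+(\Phi\phi_t)(x)$, $\phi_0=\phi$; it satisfies $c_\phi e^{-t}\psi(x)\le1-\phi_t(x)\le\psi(x)$. Operator. For $\phi\in C_\psi(X)$, $F^\phi(\gamma)=\prod_{x\in\gamma}\phi(x)$, $\gamma\in\Gamma^\psi$. $E^0(\Gamma^\psi)$ is the linear span of $\{F^\phi:\phi\in C_\psi(X)\}$ in $C_{\rm b}(\Gamma^\psi)$, on which $(LF)(\gamma)=\sum_{x\in\gamma}\int_\Gamma[F(\gamma\setminus x\cup\xi)-F(\gamma)]\,b_x(d\xi)$; one has $LF\in C_{\rm b}(\Gamma^\psi)$ for such $F$. $\mathcal{D}(L)\subset C_{\rm b}(\Gamma^\psi)$ is the closure of $E^0(\Gamma^\psi)$ in the graph norm $\|F\|_L=\|F\|+\|LF\|$ ($\|\cdot\|$ the supremum norm), and $(L,\mathcal{D}(L))$ is the resulting closed operator. A classical solution of the Cauchy problem is a continuously differentiable map $[0,+\infty)\ni t\mapsto F_t\in\mathcal{D}(L)\subset C_{\rm b}(\Gamma^\psi)$ (differentiability in the norm of $C_{\rm b}(\Gamma^\psi)$) such that both equalities hold. *)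

theory Defs
  imports "HOL-Probability.Probability"
begin

section \<open>Weak topologies and the supremum norm\<close>

definition weak_topology :: "'c set \<Rightarrow> ('c \<Rightarrow> real) set \<Rightarrow> 'c topology" where
  "weak_topology S H = topology_generated_by {{\<gamma> \<in> S. h \<gamma> \<in> U} | h U. h \<in> H \<and> open U}"

definition Cb :: "'c topology \<Rightarrow> ('c \<Rightarrow> real) set" where
  "Cb T = {F. continuous_map T euclideanreal F \<and> bounded (F ` topspace T)}"

text \<open>Elements of \<open>Cb T\<close> are represented by functions on the whole type. Only their values on
  \<open>topspace T\<close> matter; the norm below does not see the others.\<close>

definition sup_norm :: "'c topology \<Rightarrow> ('c \<Rightarrow> real) \<Rightarrow> real" where
  "sup_norm T F = (SUP \<gamma>\<in>topspace T. \<bar>F \<gamma>\<bar>)"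


section \<open>Configurations\<close>

text \<open>A configuration is given by its multiplicities: \<open>\<gamma> x\<close> is the number of particles at \<open>x\<close>.
  Sums and products over the particles therefore become weighted sums and products over
  the locations.\<close>

type_synonym 'a config = "'a \<Rightarrow> nat"

definition configs :: "('a::topological_space) config set" where
  "configs = {\<gamma>. \<forall>K. compact K \<longrightarrow> finite {x \<in> K. \<gamma> x \<noteq> 0}}"

definition config_sum :: "'a config \<Rightarrow> ('a \<Rightarrow> 'b) \<Rightarrow> 'b::{t2_space, semiring_1}" where
  "config_sum \<gamma> h = (\<Sum>\<^sub>\<infinity>x. of_nat (\<gamma> x) * h x)"

text \<open>As for \<^const>\<open>infsum\<close>, the possibly infinite product is the limit of the products over the
  finite sets of locations.\<close>

definition config_prod :: "'a config \<Rightarrow> ('a \<Rightarrow> real) \<Rightarrow> real" where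
  "config_prod \<gamma> h = Lim (finite_subsets_at_top {x. \<gamma> x \<noteq> 0}) (\<lambda>A. \<Prod>x\<in>A. h x ^ \<gamma> x)"

definition vague_topology :: "('a::topological_space) config topology" where
  "vague_topology = weak_topology configs
     {\<lambda>\<gamma>. config_sum \<gamma> g | g. continuous_on UNIV g \<and> compact (closure {x. g x \<noteq> 0})}"

definition config_borel :: "('a::topological_space) config measure" where
  "config_borel = sigma configs {U. openin vague_topology U}"

definition finite_configs :: "('a::topological_space) config set" where
  "finite_configs = {\<xi> \<in> configs. finite {x. \<xi> x \<noteq> 0}}"

definition config_size :: "'a config \<Rightarrow> nat" where
  "config_size \<xi> = (\<Sum>x | \<xi> x \<noteq> 0. \<xi> x)"

definition empty_config :: "'a config" where
  "empty_config = (\<lambda>x. 0)"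

definition replace_particle :: "'a config \<Rightarrow> 'a \<Rightarrow> 'a config \<Rightarrow> 'a config" where
  "replace_particle \<gamma> x \<xi> = (\<lambda>y. (if y = x then \<gamma> y - 1 else \<gamma> y) + \<xi> y)"

definition tempered_configs :: "(('a::topological_space) \<Rightarrow> real) \<Rightarrow> 'a config set" where
  "tempered_configs \<psi> = {\<gamma> \<in> configs. config_sum \<gamma> (\<lambda>x. ennreal (\<psi> x)) < \<top>}"

definition tempered_topology :: "(('a::topological_space) \<Rightarrow> real) \<Rightarrow> 'a config topology" where
  "tempered_topology \<psi> = weak_topology (tempered_configs \<psi>)
     {\<lambda>\<gamma>. config_sum \<gamma> (\<lambda>x. g x * \<psi> x) | g. g \<in> bcontfun}"


section \<open>Branching kernels\<close>

text \<open>All branching laws used below are carried by the finite configurations, so integrals of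
  functions that are only meaningful on tempered configurations are taken over
  \<^const>\<open>finite_configs\<close>.\<close>

definition death_prob :: "('a \<Rightarrow> ('a::topological_space) config measure) \<Rightarrow> 'a \<Rightarrow> real" where
  "death_prob b x = measure (b x) {empty_config}"

definition mean_offspring :: "('a \<Rightarrow> ('a::topological_space) config measure) \<Rightarrow> 'a \<Rightarrow> ennreal" where
  "mean_offspring b x = (\<integral>\<^sup>+\<xi>\<in>finite_configs. of_nat (config_size \<xi>) \<partial>b x)"

definition max_mean_offspring :: "('a \<Rightarrow> ('a::topological_space) config measure) \<Rightarrow> ennreal" where
  "max_mean_offspring b = (SUP x. mean_offspring b x)"

definition first_moment_measure ::
  "('a::topological_space) config measure \<Rightarrow> 'a measure \<Rightarrow> bool" where
  "first_moment_measure P \<beta> \<longleftrightarrow> sets \<beta> = sets borel \<and>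
     (\<forall>h :: 'a \<Rightarrow> ennreal. h \<in> borel_measurable borel \<longrightarrow>
        (\<integral>\<^sup>+\<xi>. config_sum \<xi> h \<partial>P) = (\<integral>\<^sup>+y. h y \<partial>\<beta>))"

definition gen_fun ::
  "('a \<Rightarrow> ('a::topological_space) config measure) \<Rightarrow> ('a \<Rightarrow> real) \<Rightarrow> 'a \<Rightarrow> real" where
  "gen_fun b \<phi> x = (LINT \<xi>:finite_configs|b x. config_prod \<xi> \<phi>)"

locale branching_system =
  fixes \<psi> :: "'a::polish_space \<Rightarrow> real"
    and b :: "'a \<Rightarrow> 'a config measure"
    and \<beta> :: "'a \<Rightarrow> 'a measure"
  assumes locally_compact: "locally compact (UNIV :: 'a set)"
    and psi_continuous: "continuous_on UNIV \<psi>"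
    and psi_range: "0 < \<psi> x" "\<psi> x \<le> 1"
    and psi_vanishes: "0 < \<epsilon> \<Longrightarrow> \<exists>K. compact K \<and> (\<forall>x. x \<notin> K \<longrightarrow> \<psi> x < \<epsilon>)"
    and psi_inf_pos: "compact K \<Longrightarrow> K \<noteq> {} \<Longrightarrow> 0 < (INF x\<in>K. \<psi> x)"
    and kernel: "b \<in> borel \<rightarrow>\<^sub>M prob_algebra config_borel"
    and carried_by_finite: "measure (b x) finite_configs = 1"
    and moment: "first_moment_measure (b x) (\<beta> x)"
    and gen_fun_continuous:
      "g \<in> bcontfun \<Longrightarrow> (\<And>x. 0 \<le> g x) \<Longrightarrow> gen_fun b (\<lambda>x. exp (- (g x * \<psi> x))) \<in> bcontfun"
    and offspring_finite: "max_mean_offspring b < \<top>"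
    and death_bound:
      "\<exists>d>0. \<forall>x. death_prob b x \<ge> 1 - \<psi> x \<and> 1 - \<psi> x \<ge> d"
    and moment_bound:
      "\<exists>m>0. \<forall>x. (\<integral>\<^sup>+y. ennreal (\<psi> y) \<partial>\<beta> x) \<le> mean_offspring b x * ennreal (m * \<psi> x)"


section \<open>The evolution of the test functions\<close>

definition C_psi ::
  "(('a::topological_space) \<Rightarrow> real) \<Rightarrow> ('a \<Rightarrow> 'a config measure) \<Rightarrow> ('a \<Rightarrow>\<^sub>C real) set" where
  "C_psi \<psi> b = {\<phi> :: 'a \<Rightarrow>\<^sub>C real. \<exists>c>0. \<forall>x. c * \<psi> x \<le> 1 - \<phi> x \<and> 1 - \<phi> x \<le> 1 - death_prob b x}"

definition test_flow ::
  "(('a::topological_space) \<Rightarrow> real) \<Rightarrow> ('a \<Rightarrow> 'a config measure) \<Rightarrow> ('a \<Rightarrow>\<^sub>C real) \<Rightarrow>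
   (real \<Rightarrow> ('a \<Rightarrow>\<^sub>C real)) \<Rightarrow> bool" where
  "test_flow \<psi> b \<phi> u \<longleftrightarrow> u 0 = \<phi> \<and> (\<forall>t\<ge>0. u t \<in> C_psi \<psi> b) \<and>
     (\<exists>u'. continuous_on {0..} u' \<and>
        (\<forall>t\<ge>0. (u has_vector_derivative u' t) (at t within {0..}) \<and>
           (\<forall>x. u' t x = - u t x + gen_fun b (u t) x)))"


section \<open>The generator\<close>

definition F_exp :: "(('a::topological_space) \<Rightarrow>\<^sub>C real) \<Rightarrow> 'a config \<Rightarrow> real" where
  "F_exp \<phi> \<gamma> = config_prod \<gamma> \<phi>"

definition E0 ::
  "(('a::topological_space) \<Rightarrow> real) \<Rightarrow> ('a \<Rightarrow> 'a config measure) \<Rightarrow> ('a config \<Rightarrow> real) set" where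
  "E0 \<psi> b = {\<lambda>\<gamma>. \<Sum>\<phi>\<in>A. c \<phi> * F_exp \<phi> \<gamma> | A c. finite A \<and> A \<subseteq> C_psi \<psi> b}"

definition pre_generator ::
  "('a \<Rightarrow> ('a::topological_space) config measure) \<Rightarrow> ('a config \<Rightarrow> real) \<Rightarrow> 'a config \<Rightarrow> real" where
  "pre_generator b F \<gamma> =
     config_sum \<gamma> (\<lambda>x. LINT \<xi>:finite_configs|b x. F (replace_particle \<gamma> x \<xi>) - F \<gamma>)"

definition generator_graph ::
  "(('a::topological_space) \<Rightarrow> real) \<Rightarrow> ('a \<Rightarrow> 'a config measure) \<Rightarrow>
   (('a config \<Rightarrow> real) \<times> ('a config \<Rightarrow> real)) set" where
  "generator_graph \<psi> b = {(F, G). F \<in> Cb (tempered_topology \<psi>) \<and> G \<in> Cb (tempered_topology \<psi>) \<and>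
     (\<exists>H. (\<forall>n::nat. H n \<in> E0 \<psi> b) \<and>
        (\<lambda>n. sup_norm (tempered_topology \<psi>) (\<lambda>\<gamma>. H n \<gamma> - F \<gamma>) +
             sup_norm (tempered_topology \<psi>) (\<lambda>\<gamma>. pre_generator b (H n) \<gamma> - G \<gamma>))
          \<longlonglongrightarrow> 0)}"

definition generator_domain ::
  "(('a::topological_space) \<Rightarrow> real) \<Rightarrow> ('a \<Rightarrow> 'a config measure) \<Rightarrow> ('a config \<Rightarrow> real) set" where
  "generator_domain \<psi> b = Domain (generator_graph \<psi> b)"

text \<open>The graph determines its second component only on the tempered configurations, hence the
  pointwise definition.\<close>

definition generator ::
  "(('a::topological_space) \<Rightarrow> real) \<Rightarrow> ('a \<Rightarrow> 'a config measure) \<Rightarrow>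
   ('a config \<Rightarrow> real) \<Rightarrow> 'a config \<Rightarrow> real" where
  "generator \<psi> b F \<gamma> = (THE r. \<exists>G. (F, G) \<in> generator_graph \<psi> b \<and> r = G \<gamma>)"

definition has_norm_derivative ::
  "'c topology \<Rightarrow> (real \<Rightarrow> 'c \<Rightarrow> real) \<Rightarrow> ('c \<Rightarrow> real) \<Rightarrow> real \<Rightarrow> bool" where
  "has_norm_derivative T F D t \<longleftrightarrow>
     ((\<lambda>s. sup_norm T (\<lambda>\<gamma>. (F s \<gamma> - F t \<gamma>) / (s - t) - D \<gamma>)) \<longlongrightarrow> 0) (at t within {0..})"

definition classical_solution ::
  "(('a::topological_space) \<Rightarrow> real) \<Rightarrow> ('a \<Rightarrow> 'a config measure) \<Rightarrow>
   ('a config \<Rightarrow> real) \<Rightarrow> (real \<Rightarrow> 'a config \<Rightarrow> real) \<Rightarrow> bool" where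
  "classical_solution \<psi> b F\<^sub>0 F \<longleftrightarrow>
     (\<forall>t\<ge>0. F t \<in> generator_domain \<psi> b) \<and>
     (\<exists>F'. (\<forall>t\<ge>0. F' t \<in> Cb (tempered_topology \<psi>)) \<and>
        (\<forall>t\<ge>0. has_norm_derivative (tempered_topology \<psi>) F (F' t) t) \<and>
        (\<forall>t\<ge>0. ((\<lambda>s. sup_norm (tempered_topology \<psi>) (\<lambda>\<gamma>. F' s \<gamma> - F' t \<gamma>)) \<longlongrightarrow> 0)
           (at t within {0..})) \<and>
        (\<forall>t\<ge>0. \<forall>\<gamma>\<in>tempered_configs \<psi>. F' t \<gamma> = generator \<psi> b (F t) \<gamma>)) \<and>
     (\<forall>\<gamma>\<in>tempered_configs \<psi>. F 0 \<gamma> = F\<^sub>0 \<gamma>)"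

end

theory Submission
  imports Defs
begin

text \<open>Since \<open>F\<^sup>\<phi>(\<gamma>) = exp (\<Sum>\<^bsub>x \<in> \<gamma>\<^esub> ln \<phi>(x))\<close>, one has
  \<open>L F\<^sup>\<phi>(\<gamma>) = F\<^sup>\<phi>(\<gamma>) \<Sum>\<^bsub>x \<in> \<gamma>\<^esub> ((\<Phi> \<phi>)(x) / \<phi>(x) - 1)\<close>, and along the flow the summand is the time derivative
  of \<open>ln \<phi>\<^sub>t(x)\<close>. All increments in time are Lipschitz relative to \<open>\<psi>\<close>, so they produce powers
  of \<open>\<Psi>(\<gamma>)\<close>, which the factor \<open>F\<^sup>\<phi>(\<gamma>) \<le> exp (- c \<Psi>(\<gamma>))\<close> absorbs uniformly in \<open>\<gamma>\<close>. If \<open>n\<^sub>* < 1\<close>, then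
  \<open>1 - \<phi>\<^sub>t\<close> decays like \<open>exp (- (1 - n\<^sub>*) t)\<close> uniformly on \<open>X\<close>, and \<open>1 - \<phi>\<^sub>t \<le> \<psi>\<close>
  dominates the sums over \<open>\<gamma>\<close>.\<close>

section \<open>Weak topologies\<close>

text \<open>Closure in the graph norm makes the generator a relation, and \<open>generator\<close>
  is a definite description, so its value at an exponential must be shown independent of the
  approximating sequence before the evolution equation can be verified. A second obstacle: the lower
  bound \<open>c * exp (- t) * \<psi> x\<close> for \<open>1 - \<phi>\<^sub>t\<close> degenerates as
  time grows. The exponential that absorbs powers of the total weight is therefore uniform only on
  bounded time intervals; this suffices, since differentiability and continuity are local in time.
  Third, the sigma-algebra on configurations comes from the vague topology, which tests compactly
  supported functions only, so estimates of integrals against \<open>b x\<close> have to wait for a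
  measurability argument. The existence of the flow is part of \<open>test_flow\<close>; its lower
  bound is derived from the equation. The constant \<open>psi_gap\<close>, a lower bound for all
  test functions, keeps logarithms and quotients comparable with \<open>\<psi>\<close>.\<close>

lemma topspace_weak_topology:
  assumes "H \<noteq> {}"
  shows "topspace (weak_topology S H) = S"
proof -
  \<comment> \<open>One function suffices: its preimage of \<open>UNIV\<close> is all of
    \<open>S\<close>. For empty \<open>H\<close> the generated topology would have empty
    carrier.\<close>
  obtain h where "h \<in> H" using assms by auto
  then have "{\<gamma> \<in> S. h \<gamma> \<in> UNIV} \<in> {{\<gamma> \<in> S. h \<gamma> \<in> U} | h U. h \<in> H \<and> open U}"
    by blast
  from Union_upper[OF this] have "S \<subseteq> topspace (weak_topology S H)"
    unfolding weak_topology_def topology_generated_by_topspace by simp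
  moreover have "topspace (weak_topology S H) \<subseteq> S"
    unfolding weak_topology_def topology_generated_by_topspace by blast
  ultimately show ?thesis by blast
qed

lemma openin_weak_topology_vimage:
  assumes "h \<in> H" "open U"
  shows "openin (weak_topology S H) {\<gamma> \<in> S. h \<gamma> \<in> U}"
  unfolding weak_topology_def by (rule topology_generated_by_Basis) (use assms in blast)

lemma continuous_map_weak_topology:
  assumes "h \<in> H"
  shows "continuous_map (weak_topology S H) euclideanreal h"
proof -
  have "topspace (weak_topology S H) = S"
    using assms by (intro topspace_weak_topology) auto
  with assms show ?thesis
    by (auto simp: continuous_map_def intro: openin_weak_topology_vimage)
qed

text \<open>Convergence need only be tested on a subbase: the property that \<open>l \<in> U\<close>
  forces \<open>f\<close> eventually into \<open>U\<close> survives finite intersections and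
  arbitrary unions. It serves to prove density of the finite configurations.\<close>

lemma limitin_weak_topology:
  assumes "H \<noteq> {}" "l \<in> S" "\<forall>\<^sub>F a in A. f a \<in> S"
    and lim: "\<And>h. h \<in> H \<Longrightarrow> ((\<lambda>a. h (f a)) \<longlongrightarrow> h l) A"
  shows "limitin (weak_topology S H) f l A"
proof -
  have "l \<in> U \<longrightarrow> (\<forall>\<^sub>F a in A. f a \<in> U)"
    if "generate_topology_on {{\<gamma> \<in> S. h \<gamma> \<in> U} | h U. h \<in> H \<and> open U} U" for U
    using that
  proof induction
    case (Int a b)
    then show ?case by (auto intro: eventually_elim2)
  next
    case (UN K)
    show ?case
    proof
      assume "l \<in> \<Union>K"
      then obtain k where "k \<in> K" "l \<in> k" by auto
      with UN have "\<forall>\<^sub>F a in A. f a \<in> k" by blast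
      then show "\<forall>\<^sub>F a in A. f a \<in> \<Union>K"
        by eventually_elim (use \<open>k \<in> K\<close> in blast)
    qed
  next
    case (Basis s)
    then obtain h U where s: "s = {\<gamma> \<in> S. h \<gamma> \<in> U}" "h \<in> H" "open U" by auto
    show ?case
    proof
      assume "l \<in> s"
      then have "\<forall>\<^sub>F a in A. h (f a) \<in> U"
        using lim[OF s(2)] s topological_tendstoD by fastforce
      with assms(3) show "\<forall>\<^sub>F a in A. f a \<in> s"
        by eventually_elim (use s in auto)
    qed
  qed auto
  then show ?thesis
    using topspace_weak_topology[OF assms(1), of S] assms(2)
    by (auto simp: limitin_def weak_topology_def openin_topology_generated_by_iff)
qed

text \<open>A supremum of reals says nothing about an unbounded or empty family, so
  \<open>sup_norm\<close> obeys these rules only with a nonempty carrier and an a priori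
  bound.\<close>

lemma sup_norm_bounds:
  assumes "topspace T \<noteq> {}" and "\<And>\<gamma>. \<gamma> \<in> topspace T \<Longrightarrow> \<bar>F \<gamma>\<bar> \<le> B"
  shows sup_norm_le: "sup_norm T F \<le> B"
    and sup_norm_upper: "\<gamma> \<in> topspace T \<Longrightarrow> \<bar>F \<gamma>\<bar> \<le> sup_norm T F"
    and sup_norm_nonneg: "0 \<le> sup_norm T F"
proof -
  show "sup_norm T F \<le> B"
    unfolding sup_norm_def using assms by (intro cSUP_least)
  show upper: "\<bar>F \<gamma>\<bar> \<le> sup_norm T F" if "\<gamma> \<in> topspace T" for \<gamma>
    unfolding sup_norm_def using that assms(2) by (intro cSUP_upper bdd_aboveI2)
  show "0 \<le> sup_norm T F"
  proof -
    obtain \<gamma> where "\<gamma> \<in> topspace T" using assms(1) by blast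
    from upper[OF this] show ?thesis by linarith
  qed
qed

lemma sup_norm_tendsto_zero:
  assumes "topspace T \<noteq> {}"
    and "\<forall>\<^sub>F s in A. \<forall>\<gamma>\<in>topspace T. \<bar>F s \<gamma>\<bar> \<le> B s" and "(B \<longlongrightarrow> 0) A"
  shows "((\<lambda>s. sup_norm T (F s)) \<longlongrightarrow> 0) A"
proof (rule tendsto_sandwich[OF _ _ tendsto_const assms(3)])
  show "\<forall>\<^sub>F s in A. 0 \<le> sup_norm T (F s)"
    using assms(2) by eventually_elim (use assms(1) in \<open>auto intro: sup_norm_nonneg\<close>)
  show "\<forall>\<^sub>F s in A. sup_norm T (F s) \<le> B s"
    using assms(2) by eventually_elim (use assms(1) in \<open>auto intro: sup_norm_le\<close>)
qed

section \<open>Sums and products over configurations\<close>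

lemma config_sum_finite:
  fixes h :: "'a \<Rightarrow> 'b::{t2_space, semiring_1}"
  assumes "finite A" "{x. \<gamma> x \<noteq> 0} \<subseteq> A"
  shows "config_sum \<gamma> h = (\<Sum>x\<in>A. of_nat (\<gamma> x) * h x)"
proof -
  have "config_sum \<gamma> h = (\<Sum>\<^sub>\<infinity>x\<in>A. of_nat (\<gamma> x) * h x)"
    unfolding config_sum_def
  proof (rule infsum_cong_neutral)
    fix x assume "x \<in> UNIV - A"
    with assms(2) have "\<gamma> x = 0" by auto
    then show "of_nat (\<gamma> x) * h x = 0" by simp
  qed auto
  with assms(1) show ?thesis by simp
qed

lemma config_sum_cong:
  assumes "\<And>x. \<gamma> x \<noteq> 0 \<Longrightarrow> h x = k x"
  shows "config_sum \<gamma> h = config_sum \<gamma> k"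
  unfolding config_sum_def
proof (rule infsum_cong)
  show "of_nat (\<gamma> x) * h x = of_nat (\<gamma> x) * k x" for x
    using assms[of x] by (cases "\<gamma> x = 0") auto
qed

text \<open>The defining sum lives in \<open>ennreal\<close>, where it always converges; a divergent
  real \<open>infsum\<close> would be 0. Membership has to become summability before real sums can
  be used.\<close>

lemma tempered_configs_iff:
  assumes "\<And>x. 0 \<le> \<psi> x"
  shows "\<gamma> \<in> tempered_configs \<psi> \<longleftrightarrow>
    \<gamma> \<in> configs \<and> (\<lambda>x. real (\<gamma> x) * \<psi> x) summable_on UNIV"
proof -
  have term_eq: "of_nat (\<gamma> x) * ennreal (\<psi> x) = ennreal (real (\<gamma> x) * \<psi> x)" for x
    using assms by (simp add: ennreal_mult ennreal_of_nat_eq_real_of_nat)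
  have sum_eq: "(\<Sum>x\<in>A. of_nat (\<gamma> x) * ennreal (\<psi> x)) = ennreal (\<Sum>x\<in>A. real (\<gamma> x) * \<psi> x)" for A
    unfolding term_eq using assms by (intro sum_ennreal) auto
  have "config_sum \<gamma> (\<lambda>x. ennreal (\<psi> x)) < \<top> \<longleftrightarrow> (\<lambda>x. real (\<gamma> x) * \<psi> x) summable_on UNIV"
  proof
    assume fin: "config_sum \<gamma> (\<lambda>x. ennreal (\<psi> x)) < \<top>"
    define B where "B = enn2real (config_sum \<gamma> (\<lambda>x. ennreal (\<psi> x)))"
    have B: "config_sum \<gamma> (\<lambda>x. ennreal (\<psi> x)) = ennreal B"
      unfolding B_def using fin by simp
    show "(\<lambda>x. real (\<gamma> x) * \<psi> x) summable_on UNIV"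
    proof (rule nonneg_bdd_above_summable_on)
      show "bdd_above (sum (\<lambda>x. real (\<gamma> x) * \<psi> x) ` {F. F \<subseteq> UNIV \<and> finite F})"
      proof (rule bdd_aboveI2)
        fix F :: "'a set" assume "F \<in> {F. F \<subseteq> UNIV \<and> finite F}"
        then have "(\<Sum>x\<in>F. of_nat (\<gamma> x) * ennreal (\<psi> x)) \<le> config_sum \<gamma> (\<lambda>x. ennreal (\<psi> x))"
          unfolding config_sum_def
          by (subst infsum_finite[symmetric])
              (auto intro!: infsum_mono_neutral nonneg_summable_on_complete simp del: infsum_finite)
        then have "ennreal (\<Sum>x\<in>F. real (\<gamma> x) * \<psi> x) \<le> ennreal B"
          unfolding sum_eq B .
        then show "(\<Sum>x\<in>F. real (\<gamma> x) * \<psi> x) \<le> B"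
          by (subst (asm) ennreal_le_iff) (simp_all add: B_def)
      qed
    qed (use assms in auto)
  next
    assume *: "(\<lambda>x. real (\<gamma> x) * \<psi> x) summable_on UNIV"
    have "config_sum \<gamma> (\<lambda>x. ennreal (\<psi> x)) \<le> ennreal (\<Sum>\<^sub>\<infinity>x. real (\<gamma> x) * \<psi> x)"
      unfolding config_sum_def
    proof (rule infsum_le_finite_sums)
      fix F :: "'a set" assume "finite F"
      then show "(\<Sum>x\<in>F. of_nat (\<gamma> x) * ennreal (\<psi> x)) \<le> ennreal (\<Sum>\<^sub>\<infinity>x. real (\<gamma> x) * \<psi> x)"
        unfolding sum_eq using * assms by (intro ennreal_leI finite_sum_le_infsum) auto
    qed (intro nonneg_summable_on_complete zero_le)
    then show "config_sum \<gamma> (\<lambda>x. ennreal (\<psi> x)) < \<top>"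
      using ennreal_less_top order_le_less_trans by blast
  qed
  then show ?thesis by (auto simp: tempered_configs_def)
qed

lemma finite_configs_iff: "\<xi> \<in> finite_configs \<longleftrightarrow> finite {x. \<xi> x \<noteq> 0}"
  by (auto simp: finite_configs_def configs_def intro: finite_subset[of _ "{x. \<xi> x \<noteq> 0}"])

lemma finite_configs_tempered:
  assumes "\<And>x. 0 \<le> \<psi> x" "\<xi> \<in> finite_configs"
  shows "\<xi> \<in> tempered_configs \<psi>"
proof -
  have "(\<lambda>x. real (\<xi> x) * \<psi> x) summable_on {x. \<xi> x \<noteq> 0}"
    using assms(2) by (simp add: finite_configs_iff)
  then have "(\<lambda>x. real (\<xi> x) * \<psi> x) summable_on UNIV"
    by (subst summable_on_cong_neutral[where T = "{x. \<xi> x \<noteq> 0}"]) auto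
  then show ?thesis
    using assms by (auto simp: tempered_configs_iff finite_configs_def)
qed

lemma finite_configs_restrict:
  assumes "finite A"
  shows "(\<lambda>x. if x \<in> A then \<gamma> x else 0) \<in> finite_configs"
  unfolding finite_configs_iff by (rule finite_subset[OF _ assms]) (auto split: if_splits)

lemma empty_config_finite: "empty_config \<in> finite_configs"
  by (simp add: finite_configs_iff empty_config_def)

lemma config_sum_size:
  assumes "\<xi> \<in> finite_configs"
  shows "config_sum \<xi> (\<lambda>x. 1 :: ennreal) = of_nat (config_size \<xi>)"
  using assms by (simp add: config_sum_finite[OF _ order_refl] finite_configs_iff config_size_def)

text \<open>Continuity of \<open>exp\<close> carries the limit of partial sums of logarithms to the
  limit of partial products.\<close>

lemma config_prod_eq_exp:
  assumes pos: "\<And>x. 0 < h x" and "(\<lambda>x. real (\<gamma> x) * ln (h x)) summable_on UNIV"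
  shows "config_prod \<gamma> h = exp (config_sum \<gamma> (\<lambda>x. ln (h x)))"
proof -
  let ?S = "{x. \<gamma> x \<noteq> 0}"
  have "((\<lambda>x. real (\<gamma> x) * ln (h x)) has_sum config_sum \<gamma> (\<lambda>x. ln (h x))) UNIV"
    unfolding config_sum_def using assms(2) by simp
  \<comment> \<open>\<open>config_prod\<close> runs along finite subsets of the support only, so the
    sum over \<open>UNIV\<close> is first moved to the support.\<close>
  then have "((\<lambda>x. real (\<gamma> x) * ln (h x)) has_sum config_sum \<gamma> (\<lambda>x. ln (h x))) ?S"
    by (subst has_sum_cong_neutral[where T = UNIV]) auto
  then have "((\<lambda>A. exp (\<Sum>x\<in>A. real (\<gamma> x) * ln (h x))) \<longlongrightarrow> exp (config_sum \<gamma> (\<lambda>x. ln (h x))))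
    (finite_subsets_at_top ?S)"
    unfolding has_sum_def by (rule tendsto_exp)
  moreover have "exp (\<Sum>x\<in>A. real (\<gamma> x) * ln (h x)) = (\<Prod>x\<in>A. h x ^ \<gamma> x)" for A
  proof -
    have "exp (real (\<gamma> x) * ln (h x)) = h x ^ \<gamma> x" for x
      using pos[of x] by (simp add: exp_of_nat_mult)
    then show ?thesis
      by (cases "finite A") (simp_all add: exp_sum)
  qed
  ultimately show ?thesis
    unfolding config_prod_def by (intro tendsto_Lim) simp_all
qed

text \<open>The finite subsets of a finite support have a largest element, so the filter is
  principal and the limit is the value there.\<close>

lemma config_prod_finite:
  assumes "\<xi> \<in> finite_configs"
  shows "config_prod \<xi> h = (\<Prod>x | \<xi> x \<noteq> 0. h x ^ \<xi> x)"
proof -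
  let ?S = "{x. \<xi> x \<noteq> 0}"
  have "((\<lambda>A. \<Prod>x\<in>A. h x ^ \<xi> x) \<longlongrightarrow> (\<Prod>x\<in>?S. h x ^ \<xi> x)) (principal {?S})"
    by (rule tendsto_principal_singleton)
  moreover have "finite_subsets_at_top ?S = principal {?S}"
    using assms by (intro finite_subsets_at_top_finite) (simp add: finite_configs_iff)
  ultimately show ?thesis
    unfolding config_prod_def by (simp only:) (intro tendsto_Lim, simp_all add: principal_eq_bot_iff)
qed

section \<open>Generating functions\<close>

text \<open>\<open>sigma\<close> gives the intended sigma-algebra only if all generators are subsets
  of \<open>configs\<close>. The zero function, being compactly supported, shows that the carrier is
  \<open>configs\<close>.\<close>

lemma openin_vague_topology_subset:
  assumes "openin vague_topology U"
  shows "U \<subseteq> configs"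
proof -
  have "(\<lambda>\<gamma>. config_sum \<gamma> (\<lambda>x. 0)) \<in>
      {\<lambda>\<gamma>. config_sum \<gamma> g | g :: 'a \<Rightarrow> real. continuous_on UNIV g \<and> compact (closure {x. g x \<noteq> 0})}"
    by (rule CollectI, rule exI[of _ "\<lambda>x. 0"]) simp
  then have "topspace (vague_topology :: 'a config topology) = configs"
    unfolding vague_topology_def by (intro topspace_weak_topology) blast
  with openin_subset[OF assms] show ?thesis by simp
qed

lemma space_config_borel: "space config_borel = configs"
  using openin_vague_topology_subset by (simp add: config_borel_def space_measure_of_conv)

lemma sets_config_borel_openin:
  assumes "openin vague_topology U"
  shows "U \<in> sets config_borel"
proof -
  have "{U. openin vague_topology U} \<subseteq> Pow configs"
    using openin_vague_topology_subset by blast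
  then show ?thesis
    using assms by (auto simp: config_borel_def sets_measure_of_conv intro: sigma_sets.Basic)
qed

lemma borel_measurable_config_sum_vague:
  fixes g :: "'a::topological_space \<Rightarrow> real"
  assumes "continuous_on UNIV g" "compact (closure {x. g x \<noteq> 0})"
  shows "(\<lambda>\<gamma>. config_sum \<gamma> g) \<in> borel_measurable config_borel"
proof (rule borel_measurableI)
  fix S :: "real set" assume "open S"
  then have "openin vague_topology {\<gamma> \<in> configs. config_sum \<gamma> g \<in> S}"
    unfolding vague_topology_def using assms
    by (intro openin_weak_topology_vimage[where h = "\<lambda>\<gamma>. config_sum \<gamma> g"]) auto
  moreover have "(\<lambda>\<gamma>. config_sum \<gamma> g) -` S \<inter> space config_borel = {\<gamma> \<in> configs. config_sum \<gamma> g \<in> S}"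
    by (auto simp: space_config_borel)
  ultimately show "(\<lambda>\<gamma>. config_sum \<gamma> g) -` S \<inter> space config_borel \<in> sets config_borel"
    by (simp add: sets_config_borel_openin)
qed

text \<open>A common domain for the estimates on generating functions: it contains
  \<open>C_psi\<close> and also the constant 1, which lies outside \<open>C_psi\<close> but is the
  fixed point with which the flow is compared for large times.\<close>

definition unit_fun :: "('a::topological_space \<Rightarrow> real) \<Rightarrow> bool" where
  "unit_fun u \<longleftrightarrow> continuous_on UNIV u \<and> (\<forall>x. 0 < u x \<and> u x \<le> 1)"

lemma unit_fun_one: "unit_fun (\<lambda>x. 1)"
  by (simp add: unit_fun_def)

lemma config_prod_unit_fun:
  assumes "unit_fun u" "\<xi> \<in> finite_configs"
  shows "0 \<le> config_prod \<xi> u" "config_prod \<xi> u \<le> 1"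
  using assms unfolding config_prod_finite[OF assms(2)]
  by (auto simp: unit_fun_def less_imp_le intro!: prod_nonneg prod_le_1 power_le_one)

lemma config_prod_finite_eq_exp:
  assumes "\<And>x. 0 < h x" "\<xi> \<in> finite_configs"
  shows "config_prod \<xi> h = exp (config_sum \<xi> (\<lambda>x. ln (h x)))"
proof (rule config_prod_eq_exp)
  have "(\<lambda>x. real (\<xi> x) * ln (h x)) summable_on {x. \<xi> x \<noteq> 0}"
    using assms(2) by (simp add: finite_configs_iff)
  then show "(\<lambda>x. real (\<xi> x) * ln (h x)) summable_on UNIV"
    by (subst summable_on_cong_neutral[where T = "{x. \<xi> x \<noteq> 0}"]) auto
qed fact

text \<open>Telescoping: for factors of modulus at most 1, a product changes by at most the sum of
  the changes of its factors. The bound is an \<open>ennreal\<close> sum so that the first moment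
  measure applies to it.\<close>

lemma config_prod_diff_le:
  assumes "unit_fun u" "unit_fun w" "\<And>y. \<bar>u y - w y\<bar> \<le> h y" and \<xi>: "\<xi> \<in> finite_configs"
  shows "ennreal \<bar>config_prod \<xi> u - config_prod \<xi> w\<bar> \<le> config_sum \<xi> (\<lambda>y. ennreal (h y))"
proof -
  let ?S = "{x. \<xi> x \<noteq> 0}"
  have h: "0 \<le> h y" for y
    using assms(3)[of y] by linarith
  have le1: "norm (u x) \<le> 1" "norm (w x) \<le> 1" for x
    using assms(1,2) by (auto simp: unit_fun_def less_imp_le)
  have "norm (config_prod \<xi> u - config_prod \<xi> w) \<le> (\<Sum>x\<in>?S. norm (u x ^ \<xi> x - w x ^ \<xi> x))"
    unfolding config_prod_finite[OF \<xi>]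
    using le1 by (intro norm_prod_diff) (auto simp: power_abs intro!: power_le_one)
  also have "\<dots> \<le> (\<Sum>x\<in>?S. real (\<xi> x) * h x)"
  proof (rule sum_mono)
    fix x
    have "norm (u x ^ \<xi> x - w x ^ \<xi> x) \<le> real (\<xi> x) * norm (u x - w x)"
      using le1 by (rule norm_power_diff)
    also have "\<dots> \<le> real (\<xi> x) * h x"
      using assms(3)[of x] by (intro mult_left_mono) auto
    finally show "norm (u x ^ \<xi> x - w x ^ \<xi> x) \<le> real (\<xi> x) * h x" .
  qed
  finally have "ennreal \<bar>config_prod \<xi> u - config_prod \<xi> w\<bar> \<le> ennreal (\<Sum>x\<in>?S. real (\<xi> x) * h x)"
    by (intro ennreal_leI) simp
  also have "\<dots> = (\<Sum>x\<in>?S. of_nat (\<xi> x) * ennreal (h x))"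
    using h by (simp add: sum_ennreal[symmetric] ennreal_mult ennreal_of_nat_eq_real_of_nat)
  also have "\<dots> = config_sum \<xi> (\<lambda>y. ennreal (h y))"
    using \<xi> by (intro config_sum_finite[symmetric]) (auto simp: finite_configs_iff)
  finally show ?thesis .
qed

section \<open>The branching kernel and its generating functional\<close>

context branching_system
begin

lemma psi_nonneg: "0 \<le> \<psi> x"
  using psi_range(1)[of x] by simp

text \<open>The largest admissible value of the constant in \<open>death_bound\<close>; it is also a
  lower bound for every function in \<open>C_psi\<close>.\<close>

definition psi_gap :: real where
  "psi_gap = (INF x. 1 - \<psi> x)"

lemma psi_gap_pos: "0 < psi_gap"
  and psi_gap_le: "psi_gap \<le> 1 - \<psi> x"
proof -
  obtain d where d: "d > 0" "\<And>x. 1 - \<psi> x \<ge> d"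
    using death_bound by blast
  then have "d \<le> psi_gap"
    unfolding psi_gap_def by (intro cINF_greatest) auto
  with d(1) show "0 < psi_gap" by simp
  show "psi_gap \<le> 1 - \<psi> x"
    unfolding psi_gap_def using d(2) by (intro cINF_lower bdd_belowI2) auto
qed

lemma death_prob_ge: "1 - \<psi> x \<le> death_prob b x"
  using death_bound by blast

lemma prob_space_b: "prob_space (b x)"
  and sets_b: "sets (b x) = sets config_borel"
  using measurable_space[OF kernel, of x] by (auto simp: space_prob_algebra)

lemma space_b: "space (b x) = configs"
  using sets_eq_imp_space_eq[OF sets_b] by (simp add: space_config_borel)

text \<open>Measurability is not read off the topology: \<open>measure\<close> is 0 on
  non-measurable sets, so the value 1 in \<open>carried_by_finite\<close> forces it.\<close>

lemma finite_configs_sets: "(finite_configs :: 'a config set) \<in> sets config_borel"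
  using carried_by_finite[of undefined] measure_notin_sets[of finite_configs "b undefined"]
  by (auto simp: sets_b)

text \<open>The same device: a non-measurable singleton would make \<open>death_prob\<close> vanish,
  contrary to its positive lower bound \<open>psi_gap\<close>.\<close>

lemma empty_config_sets: "{empty_config :: 'a config} \<in> sets config_borel"
proof (rule ccontr)
  assume "{empty_config :: 'a config} \<notin> sets config_borel"
  then have "death_prob b x = 0" for x
    unfolding death_prob_def by (intro measure_notin_sets) (simp add: sets_b)
  moreover have "0 < death_prob b x" for x
    using death_prob_ge[of x] psi_gap_le[of x] psi_gap_pos by linarith
  ultimately show False by (metis less_irrefl)
qed

lemma AE_finite_configs: "AE \<xi> in b x. \<xi> \<in> finite_configs"
proof -
  interpret prob_space "b x" by (rule prob_space_b)
  show ?thesis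
    using carried_by_finite[of x] finite_configs_sets
    by (subst AE_in_set_eq_1) (auto simp: sets_b)
qed

text \<open>Vague continuity covers compactly supported functions only, so \<open>h\<close> is cut off by
  \<open>max 0 (min 1 ((n + 1) \<psi> - 1))\<close>, which increases to 1 since \<open>\<psi>\<close> is positive and is compactly
  supported since \<open>\<psi>\<close> vanishes at infinity.\<close>

lemma borel_measurable_config_sum_finite:
  fixes h :: "'a \<Rightarrow> real"
  assumes h: "continuous_on UNIV h"
  shows "(\<lambda>\<xi>. indicator finite_configs \<xi> * config_sum \<xi> h) \<in> borel_measurable config_borel"
proof (rule borel_measurable_LIMSEQ_real)
  define cut where "cut n x = max 0 (min 1 ((real n + 1) * \<psi> x - 1))" for n x
  have cont: "continuous_on UNIV (\<lambda>x. h x * cut n x)" for n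
    unfolding cut_def by (intro continuous_intros h psi_continuous)
  have compact: "compact (closure {x. h x * cut n x \<noteq> 0})" for n
  proof -
    obtain K where K: "compact K" "\<And>x. x \<notin> K \<Longrightarrow> \<psi> x < 1 / (real n + 1)"
      using psi_vanishes[of "1 / (real n + 1)"] by auto
    have "{x. h x * cut n x \<noteq> 0} \<subseteq> K"
    proof
      fix x assume "x \<in> {x. h x * cut n x \<noteq> 0}"
      then have "cut n x \<noteq> 0" by simp
      then have "(real n + 1) * \<psi> x > 1"
        by (auto simp: cut_def max_def min_def split: if_splits)
      then have "\<not> \<psi> x < 1 / (real n + 1)"
        by (simp add: field_simps)
      then show "x \<in> K" using K(2) by blast
    qed
    then have "closure {x. h x * cut n x \<noteq> 0} \<subseteq> K"
      using K(1) by (intro closure_minimal compact_imp_closed)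
    then have "closure {x. h x * cut n x \<noteq> 0} = K \<inter> closure {x. h x * cut n x \<noteq> 0}" by blast
    then show ?thesis
      using K(1) by (metis compact_Int_closed closed_closure)
  qed
  show "(\<lambda>\<xi>. indicator finite_configs \<xi> * config_sum \<xi> (\<lambda>x. h x * cut n x))
      \<in> borel_measurable config_borel" for n
    using borel_measurable_config_sum_vague[OF cont compact] finite_configs_sets
    by (intro borel_measurable_times borel_measurable_indicator)
  fix \<xi> :: "'a config"
  have cut: "(\<lambda>n. cut n x) \<longlonglongrightarrow> 1" for x
  proof (rule tendsto_eventually)
    obtain N :: nat where N: "2 / \<psi> x \<le> real N"
      using real_arch_simple by blast
    show "\<forall>\<^sub>F n in sequentially. cut n x = 1"
    proof (rule eventually_sequentiallyI)
      fix n assume "N \<le> n"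
      then have "2 / \<psi> x \<le> real n" using N by linarith
      then have "2 \<le> real n * \<psi> x"
        using psi_range(1)[of x] by (simp add: pos_divide_le_eq)
      then have "2 \<le> (real n + 1) * \<psi> x"
        using psi_nonneg[of x] by (simp add: distrib_right)
      then show "cut n x = 1" by (simp add: cut_def)
    qed
  qed
  show "(\<lambda>n. indicator finite_configs \<xi> * config_sum \<xi> (\<lambda>x. h x * cut n x))
      \<longlonglongrightarrow> indicator finite_configs \<xi> * config_sum \<xi> h"
  proof (cases "\<xi> \<in> finite_configs")
    case True
    then have eq: "config_sum \<xi> k = (\<Sum>x | \<xi> x \<noteq> 0. real (\<xi> x) * k x)" for k
      by (simp add: finite_configs_iff config_sum_finite)
    have "(\<lambda>n. \<Sum>x | \<xi> x \<noteq> 0. real (\<xi> x) * (h x * cut n x)) \<longlonglongrightarrow> (\<Sum>x | \<xi> x \<noteq> 0. real (\<xi> x) * (h x * 1))"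
      by (intro tendsto_intros cut)
    then show ?thesis
      using True unfolding eq by simp
  qed simp
qed

text \<open>On finite configurations the product is \<open>exp\<close> of a sum of logarithms, hence
  measurable by the cut-off argument, and it lies between 0 and 1.\<close>

lemma integrable_config_prod:
  assumes u: "unit_fun u"
  shows "integrable (b x) (\<lambda>\<xi>. indicator finite_configs \<xi> * config_prod \<xi> u)"
proof -
  interpret prob_space "b x" by (rule prob_space_b)
  \<comment> \<open>The indicator is repeated inside \<open>exp\<close> so that its argument is
    literally the function known to be measurable.\<close>
  have eq: "indicator finite_configs \<xi> * config_prod \<xi> u =
    indicator finite_configs \<xi> * exp (indicator finite_configs \<xi> * config_sum \<xi> (\<lambda>x. ln (u x)))" for \<xi>
    using u config_prod_finite_eq_exp[of u \<xi>] by (auto simp: indicator_def unit_fun_def)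
  have "continuous_on UNIV (\<lambda>x. ln (u x))"
    using u by (intro continuous_intros) (auto simp: unit_fun_def less_imp_neq[symmetric])
  then have "(\<lambda>\<xi>. indicator finite_configs \<xi> * config_prod \<xi> u) \<in> borel_measurable config_borel"
    unfolding eq using finite_configs_sets
    by (intro borel_measurable_times borel_measurable_indicator
        measurable_compose[OF borel_measurable_config_sum_finite borel_measurable_exp])
  then have "(\<lambda>\<xi>. indicator finite_configs \<xi> * config_prod \<xi> u) \<in> borel_measurable (b x)"
    using measurable_cong_sets[OF sets_b refl] by blast
  then show ?thesis
    using config_prod_unit_fun[OF u]
    by (intro integrable_const_bound[where B = 1]) (auto simp: indicator_def)
qed

lemma gen_fun_eq:
  "gen_fun b u x = (\<integral>\<xi>. indicator finite_configs \<xi> * config_prod \<xi> u \<partial>b x)"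
  by (simp add: gen_fun_def set_lebesgue_integral_def)

lemma gen_fun_one: "gen_fun b (\<lambda>x. 1) x = 1"
proof -
  have "gen_fun b (\<lambda>x. 1) x = (\<integral>\<xi>. indicator finite_configs \<xi> \<partial>b x)"
    unfolding gen_fun_eq
    by (intro Bochner_Integration.integral_cong) (auto simp: indicator_def config_prod_finite)
  moreover have "(finite_configs :: 'a config set) \<inter> space (b x) = finite_configs"
    by (auto simp: space_b finite_configs_def)
  ultimately show ?thesis
    using carried_by_finite[of x] by simp
qed

text \<open>Dying without offspring contributes an empty product, equal to 1. With
  \<open>death_prob_ge\<close> this gives \<open>1 - gen_fun b u x \<le> \<psi> x\<close>.\<close>

lemma gen_fun_bounds:
  assumes u: "unit_fun u"
  shows "death_prob b x \<le> gen_fun b u x" "gen_fun b u x \<le> 1"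
proof -
  interpret prob_space "b x" by (rule prob_space_b)
  have int: "integrable (b x) (\<lambda>\<xi>. indicator finite_configs \<xi> * config_prod \<xi> u)"
    by (rule integrable_config_prod[OF u])
  have ind: "integrable (b x) (indicator {empty_config} :: _ \<Rightarrow> real)"
    using empty_config_sets by (simp add: sets_b emeasure_finite less_top[symmetric])
  have "death_prob b x = (\<integral>\<xi>. indicator {empty_config} \<xi> \<partial>b x)"
    using sets.sets_into_space[OF empty_config_sets]
    by (simp add: death_prob_def Int_absorb2 space_b space_config_borel)
  also have "\<dots> \<le> gen_fun b u x"
    unfolding gen_fun_eq
  proof (rule integral_mono[OF ind int])
    fix \<xi>
    have "config_prod empty_config u = 1"
      by (simp add: config_prod_finite[OF empty_config_finite]) (simp add: empty_config_def)
    then show "indicator {empty_config} \<xi> \<le> indicator finite_configs \<xi> * config_prod \<xi> u"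
      using config_prod_unit_fun(1)[OF u, of \<xi>] empty_config_finite by (auto simp: indicator_def)
  qed
  finally show "death_prob b x \<le> gen_fun b u x" .
  have "gen_fun b u x \<le> (\<integral>\<xi>. 1 \<partial>b x)"
    unfolding gen_fun_eq
    using config_prod_unit_fun(2)[OF u] by (intro integral_mono[OF int]) (auto simp: indicator_def)
  then show "gen_fun b u x \<le> 1" by (simp add: prob_space)
qed

text \<open>Integrating the telescoping bound turns configurations into the first moment measure. It
  is applied with \<open>h\<close> a multiple of \<open>\<psi>\<close> for the weighted Lipschitz
  estimates and with constant \<open>h\<close> for the decay.\<close>

lemma gen_fun_diff_le:
  assumes u: "unit_fun u" and w: "unit_fun w" and le: "\<And>y. \<bar>u y - w y\<bar> \<le> h y"
    and h: "h \<in> borel_measurable borel"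
  shows "ennreal \<bar>gen_fun b u x - gen_fun b w x\<bar> \<le> (\<integral>\<^sup>+y. ennreal (h y) \<partial>\<beta> x)"
proof -
  have eq: "gen_fun b u x - gen_fun b w x = (\<integral>\<xi>. indicator finite_configs \<xi> * config_prod \<xi> u
      - indicator finite_configs \<xi> * config_prod \<xi> w \<partial>b x)"
    unfolding gen_fun_eq
    by (rule Bochner_Integration.integral_diff[symmetric]; rule integrable_config_prod[OF u]
        integrable_config_prod[OF w])
  have "ennreal \<bar>gen_fun b u x - gen_fun b w x\<bar> \<le> (\<integral>\<^sup>+\<xi>. ennreal (norm (indicator finite_configs \<xi> * config_prod \<xi> u
      - indicator finite_configs \<xi> * config_prod \<xi> w)) \<partial>b x)"
    unfolding eq real_norm_def[symmetric]
    by (intro integral_norm_bound_ennreal Bochner_Integration.integrable_diff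
        integrable_config_prod u w)
  also have "\<dots> \<le> (\<integral>\<^sup>+\<xi>. config_sum \<xi> (\<lambda>y. ennreal (h y)) \<partial>b x)"
    using config_prod_diff_le[OF u w le]
    by (intro nn_integral_mono) (auto simp: indicator_def)
  also have "\<dots> = (\<integral>\<^sup>+y. ennreal (h y) \<partial>\<beta> x)"
    using moment[of x] h by (auto simp: first_moment_measure_def)
  finally show ?thesis .
qed

lemma sets_beta: "sets (\<beta> x) = sets borel"
  using moment[of x] by (simp add: first_moment_measure_def)

text \<open>Smallness relative to \<open>\<psi>\<close> is preserved because
  \<open>moment_bound\<close> returns a multiple of \<open>\<psi> x\<close>.\<close>

lemma gen_fun_diff_le_psi:
  obtains K where "0 \<le> K"
    and "\<And>u w B x. unit_fun u \<Longrightarrow> unit_fun w \<Longrightarrow> 0 \<le> B \<Longrightarrow> (\<And>y. \<bar>u y - w y\<bar> \<le> B * \<psi> y) \<Longrightarrow>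
      \<bar>gen_fun b u x - gen_fun b w x\<bar> \<le> B * K * \<psi> x"
proof -
  obtain m where m: "m > 0"
    "\<And>x. (\<integral>\<^sup>+y. ennreal (\<psi> y) \<partial>\<beta> x) \<le> mean_offspring b x * ennreal (m * \<psi> x)"
    using moment_bound by blast
  define N where "N = enn2real (max_mean_offspring b)"
  have N: "mean_offspring b x \<le> ennreal N" for x
    unfolding N_def using offspring_finite
    by (simp add: max_mean_offspring_def SUP_upper)
  have "N \<ge> 0" by (simp add: N_def)
  have psi_meas: "\<psi> \<in> borel_measurable borel"
    by (rule borel_measurable_continuous_onI[OF psi_continuous])
  show ?thesis
  \<comment> \<open>The product of the maximal mean offspring number and the constant in
    \<open>moment_bound\<close>.\<close>
  proof (rule that[of "N * m"])
    show "0 \<le> N * m" using \<open>N \<ge> 0\<close> m by simp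
    fix u w B x assume *: "unit_fun u" "unit_fun w" "0 \<le> B" "\<And>y. \<bar>u y - w y\<bar> \<le> B * \<psi> y"
    have "ennreal \<bar>gen_fun b u x - gen_fun b w x\<bar> \<le> (\<integral>\<^sup>+y. ennreal (B * \<psi> y) \<partial>\<beta> x)"
      using * psi_meas by (intro gen_fun_diff_le) auto
    also have "\<dots> = ennreal B * (\<integral>\<^sup>+y. ennreal (\<psi> y) \<partial>\<beta> x)"
      using \<open>0 \<le> B\<close> psi_meas psi_nonneg measurable_cong_sets[OF sets_beta refl]
      by (subst nn_integral_cmult[symmetric]) (auto simp: ennreal_mult)
    also have "\<dots> \<le> ennreal B * (ennreal N * ennreal (m * \<psi> x))"
      by (intro mult_left_mono order_trans[OF m(2)] mult_right_mono N) auto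
    also have "\<dots> = ennreal (B * (N * m) * \<psi> x)"
      using \<open>0 \<le> B\<close> \<open>N \<ge> 0\<close> m(1) psi_nonneg[of x] by (simp add: ennreal_mult[symmetric] mult.assoc)
    finally show "\<bar>gen_fun b u x - gen_fun b w x\<bar> \<le> B * (N * m) * \<psi> x"
      using \<open>0 \<le> B\<close> \<open>N \<ge> 0\<close> m(1) psi_nonneg[of x] by (subst (asm) ennreal_le_iff) auto
  qed
qed

text \<open>For constant \<open>h\<close> the integral is a multiple of the total mass of
  \<open>\<beta> x\<close>, which is the mean offspring number. The generating functional is thus a
  contraction in sup distance when that number is bounded by a constant below 1.\<close>

lemma gen_fun_diff_le_const:
  assumes "unit_fun u" "unit_fun w" "0 \<le> B" "\<And>y. \<bar>u y - w y\<bar> \<le> B"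
  shows "\<bar>gen_fun b u x - gen_fun b w x\<bar> \<le> enn2real (max_mean_offspring b) * B"
proof -
  have "ennreal \<bar>gen_fun b u x - gen_fun b w x\<bar> \<le> (\<integral>\<^sup>+y. ennreal B * 1 \<partial>\<beta> x)"
    using gen_fun_diff_le[OF assms(1,2), of "\<lambda>y. B"] assms by simp
  also have "\<dots> = ennreal B * (\<integral>\<^sup>+y. 1 \<partial>\<beta> x)"
    by (rule nn_integral_cmult) simp
  also have "(\<integral>\<^sup>+y. 1 \<partial>\<beta> x) = (\<integral>\<^sup>+\<xi>. config_sum \<xi> (\<lambda>y. 1) \<partial>b x)"
    using moment[of x] unfolding first_moment_measure_def by (metis borel_measurable_const)
  also have "\<dots> = mean_offspring b x"
    \<comment> \<open>\<open>mean_offspring\<close> integrates over finite configurations only, so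
      the two integrands are compared almost everywhere.\<close>
    unfolding mean_offspring_def using AE_finite_configs[of x]
    by (intro nn_integral_cong_AE, eventually_elim) (simp add: config_sum_size)
  also have "ennreal B * mean_offspring b x \<le> ennreal B * ennreal (enn2real (max_mean_offspring b))"
    using offspring_finite by (intro mult_left_mono) (auto simp: max_mean_offspring_def SUP_upper)
  also have "\<dots> = ennreal (enn2real (max_mean_offspring b) * B)"
    using assms(3) by (simp add: ennreal_mult mult.commute)
  finally show ?thesis
    using assms(3) by (subst (asm) ennreal_le_iff) auto
qed

end

section \<open>The generator on exponential functions\<close>

text \<open>Absorbs one power of the total weight; \<open>exp z \<ge> z\<close> is enough, at the
  price of a constant that is not sharp.\<close>

lemma mult_exp_neg_le:
  fixes c y :: real
  assumes "0 < c" "0 \<le> y"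
  shows "y * exp (- (c * y)) \<le> 1 / c"
proof -
  have "c * y \<le> exp (c * y)"
    using exp_ge_add_one_self[of "c * y"] by linarith
  then have "c * y * exp (- (c * y)) \<le> exp (c * y) * exp (- (c * y))"
    by (rule mult_right_mono) simp
  then have "c * y * exp (- (c * y)) \<le> 1"
    by (simp add: exp_minus)
  then show ?thesis using assms(1) by (simp add: field_simps)
qed

lemma config_sum_cmult:
  fixes h :: "'a \<Rightarrow> real"
  shows "config_sum \<gamma> (\<lambda>x. c * h x) = c * config_sum \<gamma> h"
proof -
  have "config_sum \<gamma> (\<lambda>x. c * h x) = (\<Sum>\<^sub>\<infinity>x. c * (real (\<gamma> x) * h x))"
    unfolding config_sum_def by (simp add: algebra_simps)
  also have "\<dots> = c * config_sum \<gamma> h"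
    unfolding config_sum_def by (rule infsum_cmult_right')
  finally show ?thesis .
qed

context branching_system
begin

section \<open>Sums over tempered configurations\<close>

abbreviation tempered :: "'a config set" where
  "tempered \<equiv> tempered_configs \<psi>"

abbreviation tempered_top :: "'a config topology" where
  "tempered_top \<equiv> tempered_topology \<psi>"

lemma tempered_summable:
  assumes \<gamma>: "\<gamma> \<in> tempered" and h: "\<And>x. \<bar>h x\<bar> \<le> C * \<psi> x"
  shows "(\<lambda>x. real (\<gamma> x) * h x) summable_on UNIV"
proof -
  have "(\<lambda>x. C * (real (\<gamma> x) * \<psi> x)) summable_on UNIV"
    using \<gamma> by (intro summable_on_cmult_right) (simp add: tempered_configs_iff psi_nonneg)
  then have "(\<lambda>x. norm (real (\<gamma> x) * h x)) summable_on UNIV"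
  proof (rule Infinite_Sum.abs_summable_on_comparison_test')
    show "norm (real (\<gamma> x) * h x) \<le> C * (real (\<gamma> x) * \<psi> x)" for x
      using mult_left_mono[OF h[of x], of "real (\<gamma> x)"] by (simp add: abs_mult algebra_simps)
  qed
  then show ?thesis
    using summable_on_iff_abs_summable_on_real by blast
qed

lemma has_sum_config_sum:
  assumes "\<gamma> \<in> tempered" "\<And>x. \<bar>h x\<bar> \<le> C * \<psi> x"
  shows "((\<lambda>x. real (\<gamma> x) * h x) has_sum config_sum \<gamma> h) UNIV"
  unfolding config_sum_def using tempered_summable[OF assms] by simp

lemma config_sum_mono:
  assumes "\<gamma> \<in> tempered" "\<And>x. \<bar>h x\<bar> \<le> C * \<psi> x" "\<And>x. \<bar>k x\<bar> \<le> D * \<psi> x" "\<And>x. h x \<le> k x"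
  shows "config_sum \<gamma> h \<le> config_sum \<gamma> k"
  by (rule has_sum_mono[OF has_sum_config_sum[OF assms(1,2)] has_sum_config_sum[OF assms(1,3)]])
    (use assms(4) in \<open>auto intro: mult_left_mono\<close>)

lemma config_sum_diff:
  assumes "\<gamma> \<in> tempered" "\<And>x. \<bar>h x\<bar> \<le> C * \<psi> x" "\<And>x. \<bar>k x\<bar> \<le> D * \<psi> x"
  shows "config_sum \<gamma> (\<lambda>x. h x - k x) = config_sum \<gamma> h - config_sum \<gamma> k"
proof -
  have "((\<lambda>x. real (\<gamma> x) * h x + - (real (\<gamma> x) * k x)) has_sum config_sum \<gamma> h + - config_sum \<gamma> k) UNIV"
    using has_sum_config_sum[OF assms(1,3)]
    by (intro has_sum_add has_sum_config_sum[OF assms(1,2)]) (simp add: has_sum_uminus)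
  from infsumI[OF this] show ?thesis
    by (simp add: config_sum_def algebra_simps)
qed

lemma config_sum_sum:
  assumes \<gamma>: "\<gamma> \<in> tempered" and h: "\<And>i x. i \<in> A \<Longrightarrow> \<bar>h i x\<bar> \<le> C i * \<psi> x"
  shows "config_sum \<gamma> (\<lambda>x. \<Sum>i\<in>A. h i x) = (\<Sum>i\<in>A. config_sum \<gamma> (h i))"
proof -
  have "((\<lambda>x. \<Sum>i\<in>A. real (\<gamma> x) * h i x) has_sum (\<Sum>i\<in>A. config_sum \<gamma> (h i))) UNIV"
    using h
  proof (induction A rule: infinite_finite_induct)
    case (insert i A)
    have "((\<lambda>x. real (\<gamma> x) * h i x) has_sum config_sum \<gamma> (h i)) UNIV"
      using insert.prems by (intro has_sum_config_sum[OF \<gamma>, of _ "C i"]) simp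
    with insert show ?case by (simp add: has_sum_add)
  qed simp_all
  from infsumI[OF this] show ?thesis
    by (simp add: config_sum_def sum_distrib_left)
qed

lemma psi_self_bound: "\<bar>\<psi> x\<bar> \<le> 1 * \<psi> x"
  using psi_nonneg[of x] by simp

lemma config_sum_psi_nonneg: "0 \<le> config_sum \<gamma> \<psi>"
  unfolding config_sum_def by (intro infsum_nonneg) (simp add: psi_nonneg)

lemma config_sum_abs_le:
  assumes "\<gamma> \<in> tempered" "\<And>x. \<bar>h x\<bar> \<le> C * \<psi> x"
  shows "\<bar>config_sum \<gamma> h\<bar> \<le> C * config_sum \<gamma> \<psi>"
proof -
  \<comment> \<open>The hypothesis on \<open>h\<close> itself makes \<open>C * \<psi> x\<close>
    nonnegative.\<close>
  have C: "\<bar>C * \<psi> x\<bar> \<le> C * \<psi> x" "\<bar>- C * \<psi> x\<bar> \<le> C * \<psi> x" for x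
    using assms(2)[of x] by linarith+
  have "config_sum \<gamma> h \<le> config_sum \<gamma> (\<lambda>x. C * \<psi> x)"
    using assms(2) by (intro config_sum_mono[OF assms C(1)]) (auto simp: abs_le_iff)
  moreover have "config_sum \<gamma> (\<lambda>x. - C * \<psi> x) \<le> config_sum \<gamma> h"
  proof (rule config_sum_mono[OF assms(1) C(2) assms(2)])
    show "- C * \<psi> x \<le> h x" for x using assms(2)[of x] by linarith
  qed
  ultimately show ?thesis
    unfolding config_sum_cmult by (simp add: abs_le_iff)
qed

section \<open>Test functions and their exponentials\<close>

lemma C_psi_bounds:
  assumes "\<phi> \<in> C_psi \<psi> b"
  shows "1 - \<phi> x \<le> \<psi> x" "psi_gap \<le> \<phi> x" "0 < \<phi> x" "\<phi> x \<le> 1"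
proof -
  obtain c where c: "c > 0" "\<And>x. c * \<psi> x \<le> 1 - \<phi> x" "\<And>x. 1 - \<phi> x \<le> 1 - death_prob b x"
    using assms by (auto simp: C_psi_def)
  show 1: "1 - \<phi> x \<le> \<psi> x"
    using c(3)[of x] death_prob_ge[of x] by linarith
  show 2: "psi_gap \<le> \<phi> x"
    using 1 psi_gap_le[of x] by linarith
  show "0 < \<phi> x" using 2 psi_gap_pos by linarith
  have "0 \<le> c * \<psi> x" using c(1) psi_nonneg[of x] by simp
  then show "\<phi> x \<le> 1" using c(2)[of x] by linarith
qed

lemma C_psi_unit_fun:
  assumes "\<phi> \<in> C_psi \<psi> b"
  shows "unit_fun (apply_bcontfun \<phi>)"
  using C_psi_bounds[OF assms] by (simp add: unit_fun_def)

text \<open>Apply \<open>ln y \<le> y - 1\<close> at \<open>y = 1 / \<phi> x\<close> and bound the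
  denominator by \<open>psi_gap\<close>. The first form keeps \<open>1 - \<phi> x\<close> for the
  large time limit, the second gives summability.\<close>

lemma C_psi_ln_bound:
  assumes "\<phi> \<in> C_psi \<psi> b"
  shows "\<bar>ln (\<phi> x)\<bar> \<le> (1 - \<phi> x) / psi_gap"
    and "\<bar>ln (\<phi> x)\<bar> \<le> 1 / psi_gap * \<psi> x"
proof -
  note bounds = C_psi_bounds[OF assms, of x]
  have "ln (1 / \<phi> x) \<le> 1 / \<phi> x - 1"
    using bounds by (intro ln_le_minus_one) simp
  then have "- ln (\<phi> x) \<le> (1 - \<phi> x) / \<phi> x"
    using bounds by (simp add: ln_div field_simps)
  also have "\<dots> \<le> (1 - \<phi> x) / psi_gap"
    using bounds psi_gap_pos by (intro divide_left_mono) auto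
  finally show 1: "\<bar>ln (\<phi> x)\<bar> \<le> (1 - \<phi> x) / psi_gap"
    using bounds by simp
  also have "\<dots> \<le> \<psi> x / psi_gap"
    using bounds psi_gap_pos by (intro divide_right_mono) auto
  finally show "\<bar>ln (\<phi> x)\<bar> \<le> 1 / psi_gap * \<psi> x" by simp
qed

lemma F_exp_eq:
  assumes "\<phi> \<in> C_psi \<psi> b" "\<gamma> \<in> tempered"
  shows "F_exp \<phi> \<gamma> = exp (config_sum \<gamma> (\<lambda>x. ln (\<phi> x)))"
  unfolding F_exp_def
  by (intro config_prod_eq_exp C_psi_bounds(3)[OF assms(1)]
      tempered_summable[OF assms(2) C_psi_ln_bound(2)[OF assms(1)]])

text \<open>Termwise from \<open>ln y \<le> y - 1\<close>; exponentiated, it is the decay of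
  \<open>F_exp\<close> in the total weight.\<close>

lemma config_sum_ln_le:
  assumes "\<phi> \<in> C_psi \<psi> b" "\<And>x. c * \<psi> x \<le> 1 - \<phi> x" "\<gamma> \<in> tempered"
  shows "config_sum \<gamma> (\<lambda>x. ln (\<phi> x)) \<le> - (c * config_sum \<gamma> \<psi>)"
proof -
  have "config_sum \<gamma> (\<lambda>x. ln (\<phi> x)) \<le> config_sum \<gamma> (\<lambda>x. - c * \<psi> x)"
  proof (rule config_sum_mono[OF assms(3) C_psi_ln_bound(2)[OF assms(1)]])
    show "\<bar>- c * \<psi> x\<bar> \<le> \<bar>c\<bar> * \<psi> x" for x
      using psi_nonneg[of x] by (simp add: abs_mult)
    show "ln (\<phi> x) \<le> - c * \<psi> x" for x
      using ln_le_minus_one[OF C_psi_bounds(3)[OF assms(1), of x]] assms(2)[of x] by linarith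
  qed
  then show ?thesis unfolding config_sum_cmult by simp
qed

text \<open>The logarithmic derivative of the test function flow.\<close>

definition drift :: "('a \<Rightarrow> real) \<Rightarrow> 'a \<Rightarrow> real" where
  "drift u x = gen_fun b u x / u x - 1"

text \<open>Both \<open>gen_fun b \<phi> x\<close> and \<open>\<phi> x\<close> lie between
  \<open>1 - \<psi> x\<close> and 1, so they differ by at most \<open>\<psi> x\<close>.\<close>

lemma drift_bound:
  assumes "\<phi> \<in> C_psi \<psi> b"
  shows "\<bar>drift \<phi> x\<bar> \<le> 1 / psi_gap * \<psi> x"
proof -
  note bounds = C_psi_bounds[OF assms, of x]
  have "\<bar>gen_fun b \<phi> x - \<phi> x\<bar> \<le> \<psi> x"
    using gen_fun_bounds[OF C_psi_unit_fun[OF assms], of x] death_prob_ge[of x] bounds by linarith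
  then have "\<bar>gen_fun b \<phi> x - \<phi> x\<bar> / \<phi> x \<le> \<psi> x / psi_gap"
    using bounds psi_gap_pos by (intro frac_le) auto
  moreover have "drift \<phi> x = (gen_fun b \<phi> x - \<phi> x) / \<phi> x"
    using bounds(3) by (simp add: drift_def diff_divide_distrib)
  ultimately show ?thesis using bounds(3) by simp
qed

text \<open>The assumption \<open>gen_fun_continuous\<close> speaks of functions
  \<open>exp (- (g x * \<psi> x))\<close> with bounded \<open>g\<close>. Solving for
  \<open>g\<close> gives \<open>- ln (\<phi> x) / \<psi> x\<close>, which is bounded because the
  logarithm is dominated by \<open>\<psi>\<close>.\<close>

lemma continuous_on_gen_fun:
  assumes "\<phi> \<in> C_psi \<psi> b"
  shows "continuous_on UNIV (gen_fun b \<phi>)"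
proof -
  define g where "g x = - ln (\<phi> x) / \<psi> x" for x
  note bounds = C_psi_bounds[OF assms]
  have g_bound: "norm (g x) \<le> 1 / psi_gap" for x
    using C_psi_ln_bound(2)[OF assms, of x] psi_range(1)[of x] psi_gap_pos
    by (simp add: g_def abs_divide field_simps)
  have "continuous_on UNIV g"
    unfolding g_def using bounds psi_range(1)
    by (intro continuous_intros psi_continuous) (auto simp: less_imp_neq[symmetric])
  then have "g \<in> bcontfun"
    using g_bound by (rule bcontfun_normI)
  moreover have "0 \<le> g x" for x
    using bounds(3,4)[of x] psi_range(1)[of x] by (simp add: g_def divide_nonpos_pos)
  ultimately have "gen_fun b (\<lambda>x. exp (- (g x * \<psi> x))) \<in> bcontfun"
    by (rule gen_fun_continuous)
  moreover have "(\<lambda>x. exp (- (g x * \<psi> x))) = \<phi>"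
  proof
    show "exp (- (g x * \<psi> x)) = \<phi> x" for x
      using bounds(3)[of x] psi_range(1)[of x] by (simp add: g_def)
  qed
  ultimately show ?thesis by (simp add: bcontfun_def)
qed

lemma continuous_on_drift:
  assumes "\<phi> \<in> C_psi \<psi> b"
  shows "continuous_on UNIV (drift \<phi>)"
  unfolding drift_def[abs_def] using C_psi_bounds(3)[OF assms]
  by (intro continuous_intros continuous_on_gen_fun assms) (auto simp: less_imp_neq[symmetric])

section \<open>Continuity and boundedness on tempered configurations\<close>

lemma tempered_generators_nonempty:
  "{\<lambda>\<gamma>. config_sum \<gamma> (\<lambda>x. g x * \<psi> x) | g. g \<in> bcontfun} \<noteq> {}"
  using const_bcontfun[of 0] by blast

lemma topspace_tempered [simp]: "topspace tempered_top = tempered"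
  unfolding tempered_topology_def by (rule topspace_weak_topology[OF tempered_generators_nonempty])

lemma empty_config_tempered: "empty_config \<in> tempered"
  by (rule finite_configs_tempered[OF psi_nonneg empty_config_finite])

lemma topspace_tempered_nonempty: "topspace tempered_top \<noteq> {}"
  using empty_config_tempered by (metis empty_iff topspace_tempered)

text \<open>Divide by the weight: \<open>h x / \<psi> x\<close> is bounded and continuous, so the
  sum is one of the functions that generate the topology.\<close>

lemma continuous_map_config_sum:
  assumes h: "continuous_on UNIV h" "\<And>x. \<bar>h x\<bar> \<le> C * \<psi> x"
  shows "continuous_map tempered_top euclideanreal (\<lambda>\<gamma>. config_sum \<gamma> h)"
proof -
  have "continuous_on UNIV (\<lambda>x. h x / \<psi> x)"
    using psi_range(1) by (intro continuous_intros h psi_continuous) (auto simp: less_imp_neq[symmetric])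
  moreover have "norm (h x / \<psi> x) \<le> C" for x
    using h(2)[of x] psi_range(1)[of x] by (simp add: abs_divide pos_divide_le_eq)
  ultimately have "(\<lambda>x. h x / \<psi> x) \<in> bcontfun"
    by (rule bcontfun_normI)
  then have "continuous_map tempered_top euclideanreal (\<lambda>\<gamma>. config_sum \<gamma> (\<lambda>x. h x / \<psi> x * \<psi> x))"
    unfolding tempered_topology_def by (intro continuous_map_weak_topology CollectI exI[of _ "\<lambda>x. h x / \<psi> x"] conjI refl)
  moreover have "(\<lambda>x. h x / \<psi> x * \<psi> x) = h"
    using psi_range(1) by (simp add: less_imp_neq[symmetric])
  ultimately show ?thesis by simp
qed

lemma continuous_map_F_exp:
  assumes "\<phi> \<in> C_psi \<psi> b"
  shows "continuous_map tempered_top euclideanreal (F_exp \<phi>)"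
proof (rule continuous_map_eq)
  have "continuous_on UNIV (\<lambda>x. ln (\<phi> x))"
    using C_psi_bounds(3)[OF assms] by (intro continuous_intros) (auto simp: less_imp_neq[symmetric])
  then have "continuous_map tempered_top euclideanreal (\<lambda>\<gamma>. config_sum \<gamma> (\<lambda>x. ln (\<phi> x)))"
    by (rule continuous_map_config_sum[OF _ C_psi_ln_bound(2)[OF assms]])
  moreover have "continuous_map euclideanreal euclideanreal (exp :: real \<Rightarrow> real)"
    by (simp add: continuous_on_exp)
  ultimately have "continuous_map tempered_top euclideanreal (exp \<circ> (\<lambda>\<gamma>. config_sum \<gamma> (\<lambda>x. ln (\<phi> x))))"
    by (rule continuous_map_compose)
  then show "continuous_map tempered_top euclideanreal (\<lambda>\<gamma>. exp (config_sum \<gamma> (\<lambda>x. ln (\<phi> x))))"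
    by (simp add: o_def)
qed (use F_exp_eq[OF assms] in simp)

lemma F_exp_range:
  assumes "\<phi> \<in> C_psi \<psi> b" "\<gamma> \<in> tempered"
  shows "0 < F_exp \<phi> \<gamma>" "F_exp \<phi> \<gamma> \<le> 1"
proof -
  have "0 * \<psi> x \<le> 1 - \<phi> x" for x
    using C_psi_bounds(4)[OF assms(1), of x] by simp
  from config_sum_ln_le[OF assms(1) this assms(2)]
  show "0 < F_exp \<phi> \<gamma>" "F_exp \<phi> \<gamma> \<le> 1"
    unfolding F_exp_eq[OF assms] by simp_all
qed

definition L_exp :: "('a \<Rightarrow>\<^sub>C real) \<Rightarrow> 'a config \<Rightarrow> real" where
  "L_exp \<phi> \<gamma> = F_exp \<phi> \<gamma> * config_sum \<gamma> (drift \<phi>)"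

lemma L_exp_bounded:
  assumes \<phi>: "\<phi> \<in> C_psi \<psi> b"
  obtains B where "\<And>\<gamma>. \<gamma> \<in> tempered \<Longrightarrow> \<bar>L_exp \<phi> \<gamma>\<bar> \<le> B"
proof -
  obtain c where c: "c > 0" "\<And>x. c * \<psi> x \<le> 1 - \<phi> x"
    using \<phi> by (auto simp: C_psi_def)
  have "\<bar>L_exp \<phi> \<gamma>\<bar> \<le> 1 / c / psi_gap" if \<gamma>: "\<gamma> \<in> tempered" for \<gamma>
  proof -
    have "F_exp \<phi> \<gamma> \<le> exp (- (c * config_sum \<gamma> \<psi>))"
      unfolding F_exp_eq[OF \<phi> \<gamma>] using config_sum_ln_le[OF \<phi> c(2) \<gamma>] by simp
    then have "\<bar>L_exp \<phi> \<gamma>\<bar> \<le> exp (- (c * config_sum \<gamma> \<psi>)) * (1 / psi_gap * config_sum \<gamma> \<psi>)"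
      unfolding L_exp_def abs_mult
      using F_exp_range[OF \<phi> \<gamma>] config_sum_abs_le[OF \<gamma> drift_bound[OF \<phi>]]
      by (intro mult_mono) auto
    also have "\<dots> = (config_sum \<gamma> \<psi> * exp (- (c * config_sum \<gamma> \<psi>))) / psi_gap" by simp
    also have "\<dots> \<le> 1 / c / psi_gap"
      using psi_gap_pos
      by (intro divide_right_mono mult_exp_neg_le c config_sum_psi_nonneg) simp
    finally show ?thesis .
  qed
  then show ?thesis by (rule that)
qed

lemma F_exp_Cb:
  assumes "\<phi> \<in> C_psi \<psi> b"
  shows "F_exp \<phi> \<in> Cb tempered_top"
proof -
  have "\<forall>\<gamma>\<in>tempered. norm (F_exp \<phi> \<gamma>) \<le> 1"
    using F_exp_range[OF assms] by (simp add: abs_of_pos)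
  then show ?thesis
    using continuous_map_F_exp[OF assms] by (auto simp: Cb_def bounded_iff)
qed

lemma L_exp_Cb:
  assumes "\<phi> \<in> C_psi \<psi> b"
  shows "L_exp \<phi> \<in> Cb tempered_top"
proof -
  obtain B where "\<And>\<gamma>. \<gamma> \<in> tempered \<Longrightarrow> \<bar>L_exp \<phi> \<gamma>\<bar> \<le> B"
    using L_exp_bounded[OF assms] by blast
  then have "bounded (L_exp \<phi> ` tempered)"
    by (auto simp: bounded_iff)
  moreover have "continuous_map tempered_top euclideanreal (L_exp \<phi>)"
    unfolding L_exp_def[abs_def]
    by (intro continuous_map_real_mult continuous_map_F_exp assms
        continuous_map_config_sum[OF continuous_on_drift drift_bound])
  ultimately show ?thesis by (simp add: Cb_def)
qed

text \<open>As multiplicities are natural numbers, \<open>\<gamma> x \<noteq> 0\<close> is what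
  makes the subtraction in \<open>replace_particle\<close> remove exactly one particle.\<close>

lemma replace_particle_sum:
  assumes \<gamma>: "\<gamma> \<in> tempered" and \<xi>: "\<xi> \<in> finite_configs" and x: "\<gamma> x \<noteq> 0"
    and h: "\<And>x. \<bar>h x\<bar> \<le> C * \<psi> x"
  shows "((\<lambda>y. real (replace_particle \<gamma> x \<xi> y) * h y)
    has_sum config_sum \<gamma> h - h x + config_sum \<xi> h) UNIV"
proof -
  have "((\<lambda>y. if y = x then - h x else 0) has_sum - h x) UNIV"
    by (subst has_sum_cong_neutral[where T = "{x}" and g = "\<lambda>y. - h x"])
      (auto intro: has_sum_finiteI)
  then have "((\<lambda>y. real (\<gamma> y) * h y + (if y = x then - h x else 0) + real (\<xi> y) * h y)
      has_sum config_sum \<gamma> h + - h x + config_sum \<xi> h) UNIV"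
    by (intro has_sum_add has_sum_config_sum[OF \<gamma> h]
        has_sum_config_sum[OF finite_configs_tempered[OF psi_nonneg \<xi>] h])
  moreover have "real (\<gamma> y) * h y + (if y = x then - h x else 0) + real (\<xi> y) * h y =
      real (replace_particle \<gamma> x \<xi> y) * h y" for y
    using x by (simp add: replace_particle_def of_nat_diff algebra_simps)
  ultimately show ?thesis by simp
qed

lemma replace_particle_tempered:
  assumes \<gamma>: "\<gamma> \<in> tempered" and \<xi>: "\<xi> \<in> finite_configs" and x: "\<gamma> x \<noteq> 0"
  shows "replace_particle \<gamma> x \<xi> \<in> tempered"
proof -
  have "replace_particle \<gamma> x \<xi> \<in> configs"
    unfolding configs_def
  proof (intro CollectI allI impI)
    fix K :: "'a set" assume "compact K"
    then have "finite ({y \<in> K. \<gamma> y \<noteq> 0} \<union> {y. \<xi> y \<noteq> 0})"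
      using \<gamma> \<xi> by (auto simp: tempered_configs_def configs_def finite_configs_iff)
    then show "finite {y \<in> K. replace_particle \<gamma> x \<xi> y \<noteq> 0}"
      by (rule finite_subset[rotated]) (auto simp: replace_particle_def split: if_splits)
  qed
  then show ?thesis
    using replace_particle_sum[OF assms psi_self_bound]
    by (auto simp: tempered_configs_iff psi_nonneg summable_on_def)
qed

lemma F_exp_replace_particle:
  assumes \<phi>: "\<phi> \<in> C_psi \<psi> b"
    and "\<gamma> \<in> tempered" "\<xi> \<in> finite_configs" "\<gamma> x \<noteq> 0"
  shows "F_exp \<phi> (replace_particle \<gamma> x \<xi>) = F_exp \<phi> \<gamma> / \<phi> x * config_prod \<xi> \<phi>"
proof -
  have "config_sum (replace_particle \<gamma> x \<xi>) (\<lambda>x. ln (\<phi> x)) =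
      config_sum \<gamma> (\<lambda>x. ln (\<phi> x)) - ln (\<phi> x) + config_sum \<xi> (\<lambda>x. ln (\<phi> x))"
    unfolding config_sum_def[of "replace_particle _ _ _"]
    by (rule infsumI[OF replace_particle_sum[OF assms(2-4) C_psi_ln_bound(2)[OF \<phi>]]])
  moreover note C_psi_bounds(3)[OF \<phi>]
  ultimately show ?thesis
    using F_exp_eq[OF \<phi> assms(2)] F_exp_eq[OF \<phi> replace_particle_tempered[OF assms(2-4)]]
      config_prod_finite_eq_exp[OF _ assms(3), of \<phi>]
    by (simp add: exp_add exp_diff)
qed

text \<open>Replacing a particle multiplies \<open>F_exp\<close> by the product over the offspring
  divided by \<open>\<phi> x\<close>, so integration produces the generating functional.
  \<open>has_bochner_integral\<close> delivers integrability along with the value.\<close>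

lemma integral_F_exp_replace:
  assumes \<phi>: "\<phi> \<in> C_psi \<psi> b" and \<gamma>: "\<gamma> \<in> tempered" "\<gamma> x \<noteq> 0"
  shows "has_bochner_integral (b x)
    (\<lambda>\<xi>. indicator finite_configs \<xi> *\<^sub>R (F_exp \<phi> (replace_particle \<gamma> x \<xi>) - F_exp \<phi> \<gamma>))
    (F_exp \<phi> \<gamma> * drift \<phi> x)"
proof -
  interpret prob_space "b x" by (rule prob_space_b)
  have ind: "has_bochner_integral (b x) (indicator finite_configs) (1 :: real)"
    using finite_configs_sets carried_by_finite[of x]
    by (intro has_bochner_integral_real_indicator[THEN has_bochner_integral_cong[THEN iffD1, rotated -1]])
      (auto simp: sets_b emeasure_finite less_top[symmetric])
  have "has_bochner_integral (b x) (\<lambda>\<xi>. indicator finite_configs \<xi> * config_prod \<xi> \<phi>) (gen_fun b \<phi> x)"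
    unfolding gen_fun_eq
    by (intro has_bochner_integral_integrable integrable_config_prod C_psi_unit_fun \<phi>)
  then have "has_bochner_integral (b x)
      (\<lambda>\<xi>. F_exp \<phi> \<gamma> / \<phi> x * (indicator finite_configs \<xi> * config_prod \<xi> \<phi>) - F_exp \<phi> \<gamma> * indicator finite_configs \<xi>)
      (F_exp \<phi> \<gamma> / \<phi> x * gen_fun b \<phi> x - F_exp \<phi> \<gamma> * 1)"
    by (intro has_bochner_integral_diff has_bochner_integral_mult_right ind)
  moreover have "F_exp \<phi> \<gamma> / \<phi> x * gen_fun b \<phi> x - F_exp \<phi> \<gamma> * 1 = F_exp \<phi> \<gamma> * drift \<phi> x"
    by (simp add: drift_def algebra_simps)
  moreover have "F_exp \<phi> \<gamma> / \<phi> x * (indicator finite_configs \<xi> * config_prod \<xi> \<phi>)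
      - F_exp \<phi> \<gamma> * indicator finite_configs \<xi> =
      indicator finite_configs \<xi> *\<^sub>R (F_exp \<phi> (replace_particle \<gamma> x \<xi>) - F_exp \<phi> \<gamma>)" for \<xi>
    using F_exp_replace_particle[OF \<phi> \<gamma>(1) _ \<gamma>(2), of \<xi>] by (auto simp: indicator_def)
  ultimately show ?thesis by simp
qed

text \<open>The whole span is treated since the sequences that define \<open>generator_graph\<close>
  are arbitrary in \<open>E0\<close>.\<close>

lemma integral_combination_replace:
  assumes "finite A" "A \<subseteq> C_psi \<psi> b" and \<gamma>: "\<gamma> \<in> tempered" "\<gamma> x \<noteq> 0"
    and F: "F = (\<lambda>\<gamma>. \<Sum>\<phi>\<in>A. c \<phi> * F_exp \<phi> \<gamma>)"
  shows "has_bochner_integral (b x)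
    (\<lambda>\<xi>. indicator finite_configs \<xi> *\<^sub>R (F (replace_particle \<gamma> x \<xi>) - F \<gamma>))
    (\<Sum>\<phi>\<in>A. c \<phi> * (F_exp \<phi> \<gamma> * drift \<phi> x))"
proof -
  have "has_bochner_integral (b x)
    (\<lambda>\<xi>. \<Sum>\<phi>\<in>A. c \<phi> * (indicator finite_configs \<xi> *\<^sub>R (F_exp \<phi> (replace_particle \<gamma> x \<xi>) - F_exp \<phi> \<gamma>)))
    (\<Sum>\<phi>\<in>A. c \<phi> * (F_exp \<phi> \<gamma> * drift \<phi> x))"
    using assms(2)
    by (intro has_bochner_integral_sum has_bochner_integral_mult_right integral_F_exp_replace \<gamma>) auto
  then show ?thesis
    by (simp add: F sum_distrib_left sum_subtractf algebra_simps)
qed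

lemma pre_generator_combination:
  assumes "finite A" "A \<subseteq> C_psi \<psi> b" and \<gamma>: "\<gamma> \<in> tempered"
    and F: "F = (\<lambda>\<gamma>. \<Sum>\<phi>\<in>A. c \<phi> * F_exp \<phi> \<gamma>)"
  shows "pre_generator b F \<gamma> = (\<Sum>\<phi>\<in>A. c \<phi> * L_exp \<phi> \<gamma>)"
proof -
  \<comment> \<open>\<open>config_sum_cong\<close> sees occupied locations only, and there the
    integral formula applies.\<close>
  have "pre_generator b F \<gamma> = config_sum \<gamma> (\<lambda>x. \<Sum>\<phi>\<in>A. c \<phi> * F_exp \<phi> \<gamma> * drift \<phi> x)"
    unfolding pre_generator_def set_lebesgue_integral_def
    using has_bochner_integral_integral_eq[OF integral_combination_replace[OF assms(1,2) \<gamma> _ F]]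
    by (intro config_sum_cong) (simp add: mult.assoc)
  also have "\<dots> = (\<Sum>\<phi>\<in>A. config_sum \<gamma> (\<lambda>x. c \<phi> * F_exp \<phi> \<gamma> * drift \<phi> x))"
  proof (rule config_sum_sum[OF \<gamma>])
    fix \<phi> x assume "\<phi> \<in> A"
    then have "\<bar>drift \<phi> x\<bar> \<le> 1 / psi_gap * \<psi> x"
      using assms(2) by (intro drift_bound) auto
    then show "\<bar>c \<phi> * F_exp \<phi> \<gamma> * drift \<phi> x\<bar> \<le> \<bar>c \<phi> * F_exp \<phi> \<gamma>\<bar> * (1 / psi_gap) * \<psi> x"
      unfolding abs_mult[of "c \<phi> * F_exp \<phi> \<gamma>"] mult.assoc[of "\<bar>c \<phi> * F_exp \<phi> \<gamma>\<bar>"]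
      by (rule mult_left_mono) simp
  qed
  also have "\<dots> = (\<Sum>\<phi>\<in>A. c \<phi> * L_exp \<phi> \<gamma>)"
    unfolding config_sum_cmult L_exp_def by (simp add: mult.assoc)
  finally show ?thesis .
qed

lemma F_exp_singleton: "F_exp \<phi> = (\<lambda>\<gamma>. \<Sum>\<phi>\<in>{\<phi>}. 1 * F_exp \<phi> \<gamma>)"
  by simp

lemma pre_generator_F_exp:
  assumes "\<phi> \<in> C_psi \<psi> b" "\<gamma> \<in> tempered"
  shows "pre_generator b (F_exp \<phi>) \<gamma> = L_exp \<phi> \<gamma>"
  using pre_generator_combination[OF _ _ assms(2) F_exp_singleton] assms(1) by simp

lemma F_exp_E0:
  assumes "\<phi> \<in> C_psi \<psi> b"
  shows "F_exp \<phi> \<in> E0 \<psi> b"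
  unfolding E0_def using assms F_exp_singleton[of \<phi>]
  by (intro CollectI exI[of _ "{\<phi>}"] exI[of _ "\<lambda>\<phi>. 1"]) simp

lemma E0_integrable:
  assumes "F \<in> E0 \<psi> b" "\<gamma> \<in> tempered" "\<gamma> x \<noteq> 0"
  shows "integrable (b x)
    (\<lambda>\<xi>. indicator finite_configs \<xi> *\<^sub>R (F (replace_particle \<gamma> x \<xi>) - F \<gamma>))"
proof -
  obtain A c where "finite A" "A \<subseteq> C_psi \<psi> b" "F = (\<lambda>\<gamma>. \<Sum>\<phi>\<in>A. c \<phi> * F_exp \<phi> \<gamma>)"
    using assms(1) unfolding E0_def by blast
  from integral_combination_replace[OF this(1,2) assms(2,3) this(3)]
  show ?thesis by (rule integrable.intros)
qed

lemma linear_combination_bounded: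
  assumes "finite A" "\<And>\<phi>. \<phi> \<in> A \<Longrightarrow> \<exists>B. \<forall>\<gamma>\<in>T. \<bar>f \<phi> \<gamma>\<bar> \<le> (B :: real)"
  shows "\<exists>B. \<forall>\<gamma>\<in>T. \<bar>\<Sum>\<phi>\<in>A. c \<phi> * f \<phi> \<gamma>\<bar> \<le> B"
proof -
  obtain B where B: "\<And>\<phi> \<gamma>. \<phi> \<in> A \<Longrightarrow> \<gamma> \<in> T \<Longrightarrow> \<bar>f \<phi> \<gamma>\<bar> \<le> B \<phi>"
    using assms(2) by metis
  have "\<bar>\<Sum>\<phi>\<in>A. c \<phi> * f \<phi> \<gamma>\<bar> \<le> (\<Sum>\<phi>\<in>A. \<bar>c \<phi>\<bar> * B \<phi>)" if "\<gamma> \<in> T" for \<gamma>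
    using B that by (intro order_trans[OF sum_abs] sum_mono) (auto simp: abs_mult intro: mult_left_mono)
  then show ?thesis by blast
qed

text \<open>Supplies the a priori bounds without which the norms in \<open>generator_graph\<close>
  would carry no information.\<close>

lemma E0_bounded:
  assumes "F \<in> E0 \<psi> b"
  shows "\<exists>B. \<forall>\<gamma>\<in>tempered. \<bar>F \<gamma>\<bar> \<le> B" "\<exists>B. \<forall>\<gamma>\<in>tempered. \<bar>pre_generator b F \<gamma>\<bar> \<le> B"
proof -
  obtain A c where A: "finite A" "A \<subseteq> C_psi \<psi> b" and F: "F = (\<lambda>\<gamma>. \<Sum>\<phi>\<in>A. c \<phi> * F_exp \<phi> \<gamma>)"
    using assms unfolding E0_def by blast
  show "\<exists>B. \<forall>\<gamma>\<in>tempered. \<bar>F \<gamma>\<bar> \<le> B"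
    unfolding F
  proof (rule linear_combination_bounded[OF A(1)])
    fix \<phi> assume "\<phi> \<in> A"
    with A F_exp_range show "\<exists>B. \<forall>\<gamma>\<in>tempered. \<bar>F_exp \<phi> \<gamma>\<bar> \<le> B"
      by (intro exI[of _ 1]) (auto simp: abs_of_pos)
  qed
  have "\<exists>B. \<forall>\<gamma>\<in>tempered. \<bar>\<Sum>\<phi>\<in>A. c \<phi> * L_exp \<phi> \<gamma>\<bar> \<le> B"
  proof (rule linear_combination_bounded[OF A(1)])
    fix \<phi> assume "\<phi> \<in> A"
    then have "\<phi> \<in> C_psi \<psi> b" using A(2) by blast
    then show "\<exists>B. \<forall>\<gamma>\<in>tempered. \<bar>L_exp \<phi> \<gamma>\<bar> \<le> B" by (metis L_exp_bounded)
  qed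
  then show "\<exists>B. \<forall>\<gamma>\<in>tempered. \<bar>pre_generator b F \<gamma>\<bar> \<le> B"
    using pre_generator_combination[OF A _ F] by simp
qed

end

section \<open>Closability of the generator\<close>

lemma sup_norm_zero:
  assumes "topspace T \<noteq> {}"
  shows "sup_norm T (\<lambda>\<gamma>. 0) = 0"
  unfolding sup_norm_def by (subst cSUP_const[OF assms]) simp

context branching_system
begin

lemma Cb_bounded:
  assumes "F \<in> Cb tempered_top"
  shows "\<exists>B. \<forall>\<gamma>\<in>tempered. \<bar>F \<gamma>\<bar> \<le> B"
  using assms by (auto simp: Cb_def bounded_iff)

lemma tempered_sup_norm_diff:
  assumes "\<exists>B. \<forall>\<gamma>\<in>tempered. \<bar>F \<gamma>\<bar> \<le> B" "\<exists>B. \<forall>\<gamma>\<in>tempered. \<bar>G \<gamma>\<bar> \<le> B"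
  shows "0 \<le> sup_norm tempered_top (\<lambda>\<gamma>. F \<gamma> - G \<gamma>)"
    and "\<gamma> \<in> tempered \<Longrightarrow> \<bar>F \<gamma> - G \<gamma>\<bar> \<le> sup_norm tempered_top (\<lambda>\<gamma>. F \<gamma> - G \<gamma>)"
proof -
  obtain B C where BC: "\<And>\<gamma>. \<gamma> \<in> tempered \<Longrightarrow> \<bar>F \<gamma>\<bar> \<le> B" "\<And>\<gamma>. \<gamma> \<in> tempered \<Longrightarrow> \<bar>G \<gamma>\<bar> \<le> C"
    using assms by blast
  have *: "\<bar>F \<gamma> - G \<gamma>\<bar> \<le> B + C" if "\<gamma> \<in> topspace tempered_top" for \<gamma>
    using BC[of \<gamma>] that by simp
  show "0 \<le> sup_norm tempered_top (\<lambda>\<gamma>. F \<gamma> - G \<gamma>)"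
    by (rule sup_norm_nonneg[OF topspace_tempered_nonempty *])
  show "\<bar>F \<gamma> - G \<gamma>\<bar> \<le> sup_norm tempered_top (\<lambda>\<gamma>. F \<gamma> - G \<gamma>)" if "\<gamma> \<in> tempered"
    by (rule sup_norm_upper[OF topspace_tempered_nonempty *]) (use that in simp_all)
qed

text \<open>Each particle contributes an average of a difference of two values of the function, and
  each value moves by at most the sup distance; hence the factor 2 per particle.\<close>

lemma pre_generator_finite_diff:
  assumes H: "H \<in> E0 \<psi> b" and F: "F \<in> E0 \<psi> b" and \<gamma>: "\<gamma> \<in> finite_configs"
  shows "\<bar>pre_generator b H \<gamma> - pre_generator b F \<gamma>\<bar>
    \<le> (\<Sum>x | \<gamma> x \<noteq> 0. real (\<gamma> x)) * (2 * sup_norm tempered_top (\<lambda>\<gamma>. H \<gamma> - F \<gamma>))"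
proof -
  let ?a = "sup_norm tempered_top (\<lambda>\<gamma>. H \<gamma> - F \<gamma>)"
  let ?I = "\<lambda>F x \<xi>. indicator finite_configs \<xi> *\<^sub>R (F (replace_particle \<gamma> x \<xi>) - F \<gamma>)"
  have \<gamma>t: "\<gamma> \<in> tempered" by (rule finite_configs_tempered[OF psi_nonneg \<gamma>])
  note diff = tempered_sup_norm_diff[OF E0_bounded(1)[OF H] E0_bounded(1)[OF F]]
  have eq: "pre_generator b F \<gamma> = (\<Sum>x | \<gamma> x \<noteq> 0. real (\<gamma> x) * integral\<^sup>L (b x) (?I F x))" for F
    unfolding pre_generator_def set_lebesgue_integral_def
    using \<gamma> by (intro config_sum_finite) (auto simp: finite_configs_iff)
  have I: "\<bar>integral\<^sup>L (b x) (?I H x) - integral\<^sup>L (b x) (?I F x)\<bar> \<le> 2 * ?a" if x: "\<gamma> x \<noteq> 0" for x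
  proof -
    interpret prob_space "b x" by (rule prob_space_b)
    have int: "integrable (b x) (?I H x)" "integrable (b x) (?I F x)"
      using E0_integrable[OF H \<gamma>t x] E0_integrable[OF F \<gamma>t x] by auto
    have "\<bar>integral\<^sup>L (b x) (?I H x) - integral\<^sup>L (b x) (?I F x)\<bar> =
        norm (\<integral>\<xi>. ?I H x \<xi> - ?I F x \<xi> \<partial>b x)"
      using int by simp
    also have "\<dots> \<le> (\<integral>\<xi>. norm (?I H x \<xi> - ?I F x \<xi>) \<partial>b x)"
      by (rule integral_norm_bound)
    also have "\<dots> \<le> (\<integral>\<xi>. 2 * ?a \<partial>b x)"
    proof (rule integral_mono)
      show "integrable (b x) (\<lambda>\<xi>. norm (?I H x \<xi> - ?I F x \<xi>))"
        by (intro integrable_norm Bochner_Integration.integrable_diff int)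
      show "norm (?I H x \<xi> - ?I F x \<xi>) \<le> 2 * ?a" for \<xi>
      proof (cases "\<xi> \<in> finite_configs")
        case True
        with diff(2)[OF \<gamma>t] diff(2)[OF replace_particle_tempered[OF \<gamma>t True x]] show ?thesis
          by simp
      qed (use diff(1) in simp)
    qed simp
    finally show ?thesis by (simp add: prob_space)
  qed
  have "\<bar>pre_generator b H \<gamma> - pre_generator b F \<gamma>\<bar> =
      \<bar>\<Sum>x | \<gamma> x \<noteq> 0. real (\<gamma> x) * (integral\<^sup>L (b x) (?I H x) - integral\<^sup>L (b x) (?I F x))\<bar>"
    unfolding eq by (simp only: right_diff_distrib sum_subtractf)
  also have "\<dots> \<le> (\<Sum>x | \<gamma> x \<noteq> 0. real (\<gamma> x) * (2 * ?a))"
  proof (rule order_trans[OF sum_abs sum_mono])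
    fix x assume "x \<in> {x. \<gamma> x \<noteq> 0}"
    then show "\<bar>real (\<gamma> x) * (integral\<^sup>L (b x) (?I H x) - integral\<^sup>L (b x) (?I F x))\<bar> \<le> real (\<gamma> x) * (2 * ?a)"
      unfolding abs_mult abs_of_nat using I[of x] by (intro mult_left_mono) simp_all
  qed
  finally show ?thesis by (simp only: sum_distrib_right)
qed

lemma generator_graph_finite:
  assumes graph: "(F, G) \<in> generator_graph \<psi> b" and F: "F \<in> E0 \<psi> b" and \<gamma>: "\<gamma> \<in> finite_configs"
  shows "G \<gamma> = pre_generator b F \<gamma>"
proof -
  obtain H where G: "G \<in> Cb tempered_top" and H: "\<And>n::nat. H n \<in> E0 \<psi> b"
    and lim: "(\<lambda>n. sup_norm tempered_top (\<lambda>\<gamma>. H n \<gamma> - F \<gamma>) +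
             sup_norm tempered_top (\<lambda>\<gamma>. pre_generator b (H n) \<gamma> - G \<gamma>)) \<longlonglongrightarrow> 0"
    using graph by (auto simp: generator_graph_def)
  define a where "a n = sup_norm tempered_top (\<lambda>\<gamma>. H n \<gamma> - F \<gamma>)" for n
  define e where "e n = sup_norm tempered_top (\<lambda>\<gamma>. pre_generator b (H n) \<gamma> - G \<gamma>)" for n
  note ediff = tempered_sup_norm_diff[OF E0_bounded(2)[OF H] Cb_bounded[OF G], folded e_def]
  have a0: "0 \<le> a n" for n
    unfolding a_def by (rule tempered_sup_norm_diff[OF E0_bounded(1)[OF H] E0_bounded(1)[OF F]])
  have ae: "(\<lambda>n. a n + e n) \<longlonglongrightarrow> 0" using lim by (simp add: a_def e_def)
  \<comment> \<open>Both norms are nonnegative, so each is squeezed by their sum.\<close>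
  have a: "a \<longlonglongrightarrow> 0"
    by (rule tendsto_sandwich[OF _ _ tendsto_const ae]) (use a0 ediff(1) in auto)
  have e: "e \<longlonglongrightarrow> 0"
    by (rule tendsto_sandwich[OF _ _ tendsto_const ae]) (use a0 ediff(1) in auto)
  have \<gamma>t: "\<gamma> \<in> tempered" by (rule finite_configs_tempered[OF psi_nonneg \<gamma>])
  have "(\<lambda>n. pre_generator b (H n) \<gamma> - G \<gamma>) \<longlonglongrightarrow> 0"
    by (rule tendsto_rabs_zero_cancel, rule tendsto_sandwich[OF _ _ tendsto_const e])
      (use ediff(2)[OF \<gamma>t] in auto)
  moreover have "(\<lambda>n. pre_generator b (H n) \<gamma> - pre_generator b F \<gamma>) \<longlonglongrightarrow> 0"
  proof (rule Lim_null_comparison)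
    show "\<forall>\<^sub>F n in sequentially. norm (pre_generator b (H n) \<gamma> - pre_generator b F \<gamma>)
        \<le> (\<Sum>x | \<gamma> x \<noteq> 0. real (\<gamma> x)) * (2 * a n)"
      unfolding a_def real_norm_def
      by (rule always_eventually, rule allI, rule pre_generator_finite_diff[OF H F \<gamma>])
    show "(\<lambda>n. (\<Sum>x | \<gamma> x \<noteq> 0. real (\<gamma> x)) * (2 * a n)) \<longlonglongrightarrow> 0"
      by (intro tendsto_mult_right_zero a)
  qed
  ultimately show ?thesis
    by (intro LIMSEQ_unique[OF LIM_zero_cancel LIM_zero_cancel])
qed

text \<open>The sum over the restriction to \<open>A\<close> is the partial sum over
  \<open>A\<close>, so for each generating function the convergence is exactly
  \<open>has_sum\<close>.\<close>

lemma tempered_restrict_limit: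
  assumes \<gamma>: "\<gamma> \<in> tempered"
  shows "limitin tempered_top (\<lambda>A x. if x \<in> A then \<gamma> x else 0) \<gamma> (finite_subsets_at_top UNIV)"
  unfolding tempered_topology_def
proof (rule limitin_weak_topology[OF tempered_generators_nonempty \<gamma>])
  show "\<forall>\<^sub>F A in finite_subsets_at_top UNIV. (\<lambda>x. if x \<in> A then \<gamma> x else 0) \<in> tempered"
    by (rule eventually_finite_subsets_at_top_weakI)
      (intro finite_configs_tempered finite_configs_restrict psi_nonneg)
  fix h assume "h \<in> {\<lambda>\<gamma>. config_sum \<gamma> (\<lambda>x. g x * \<psi> x) | g. g \<in> bcontfun}"
  then obtain g where g: "g \<in> bcontfun" and h: "h = (\<lambda>\<gamma>. config_sum \<gamma> (\<lambda>x. g x * \<psi> x))" by auto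
  obtain C where C: "\<And>x. \<bar>g x\<bar> \<le> C"
    using g by (auto simp: bcontfun_def bounded_iff)
  have "\<bar>g x * \<psi> x\<bar> \<le> C * \<psi> x" for x
    using C[of x] psi_nonneg[of x] by (auto simp: abs_mult intro: mult_right_mono)
  from has_sum_config_sum[OF \<gamma> this]
  have lim: "((\<lambda>A. \<Sum>x\<in>A. real (\<gamma> x) * (g x * \<psi> x)) \<longlongrightarrow> h \<gamma>) (finite_subsets_at_top UNIV)"
    by (simp add: has_sum_def h)
  have "\<forall>\<^sub>F A in finite_subsets_at_top UNIV.
      (\<Sum>x\<in>A. real (\<gamma> x) * (g x * \<psi> x)) = h (\<lambda>x. if x \<in> A then \<gamma> x else 0)"
  proof (rule eventually_finite_subsets_at_top_weakI)
    fix A :: "'a set" assume "finite A"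
    then show "(\<Sum>x\<in>A. real (\<gamma> x) * (g x * \<psi> x)) = h (\<lambda>x. if x \<in> A then \<gamma> x else 0)"
      unfolding h by (subst config_sum_finite[of A]) (auto intro!: sum.cong)
  qed
  from Lim_transform_eventually[OF lim this]
  show "((\<lambda>A. h (\<lambda>x. if x \<in> A then \<gamma> x else 0)) \<longlongrightarrow> h \<gamma>) (finite_subsets_at_top UNIV)" .
qed

text \<open>On finite configurations the generator is a finite sum, so uniform convergence passes to the
  limit there; these configurations are dense.\<close>

lemma generator_graph_unique:
  assumes graph: "(F_exp \<phi>, G) \<in> generator_graph \<psi> b" and \<phi>: "\<phi> \<in> C_psi \<psi> b" and \<gamma>: "\<gamma> \<in> tempered"
  shows "G \<gamma> = L_exp \<phi> \<gamma>"
proof -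
  let ?r = "\<lambda>A x. if x \<in> A then \<gamma> x else 0"
  have lim: "((\<lambda>A. F (?r A)) \<longlongrightarrow> F \<gamma>) (finite_subsets_at_top UNIV)" if "F \<in> Cb tempered_top" for F
    using continuous_map_limit[OF _ tempered_restrict_limit[OF \<gamma>], of euclideanreal F] that
    by (simp add: Cb_def o_def)
  have G: "G \<in> Cb tempered_top"
    using graph by (auto simp: generator_graph_def)
  have "\<forall>\<^sub>F A in finite_subsets_at_top UNIV. G (?r A) = L_exp \<phi> (?r A)"
  proof (rule eventually_finite_subsets_at_top_weakI)
    fix A :: "'a set" assume "finite A"
    then have fin: "?r A \<in> finite_configs" by (rule finite_configs_restrict)
    show "G (?r A) = L_exp \<phi> (?r A)"
      using generator_graph_finite[OF graph F_exp_E0[OF \<phi>] fin]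
        pre_generator_F_exp[OF \<phi> finite_configs_tempered[OF psi_nonneg fin]] by simp
  qed
  from Lim_transform_eventually[OF lim[OF G] this] lim[OF L_exp_Cb[OF \<phi>]]
  show ?thesis
    by (intro tendsto_unique[of "finite_subsets_at_top (UNIV :: 'a set)"]) simp_all
qed

lemma generator_graph_F_exp:
  assumes \<phi>: "\<phi> \<in> C_psi \<psi> b"
  shows "(F_exp \<phi>, L_exp \<phi>) \<in> generator_graph \<psi> b"
proof -
  have "sup_norm tempered_top (\<lambda>\<gamma>. pre_generator b (F_exp \<phi>) \<gamma> - L_exp \<phi> \<gamma>) =
      sup_norm tempered_top (\<lambda>\<gamma>. 0)"
    unfolding sup_norm_def using pre_generator_F_exp[OF \<phi>] by (intro SUP_cong) simp_all
  also have "\<dots> = 0"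
    by (rule sup_norm_zero[OF topspace_tempered_nonempty])
  finally have "sup_norm tempered_top (\<lambda>\<gamma>. pre_generator b (F_exp \<phi>) \<gamma> - L_exp \<phi> \<gamma>) = 0" .
  moreover note sup_norm_zero[OF topspace_tempered_nonempty]
  ultimately show ?thesis
    unfolding generator_graph_def using F_exp_Cb[OF \<phi>] L_exp_Cb[OF \<phi>] F_exp_E0[OF \<phi>]
    by (auto intro!: exI[of _ "\<lambda>n. F_exp \<phi>"])
qed

lemma generator_F_exp:
  assumes "\<phi> \<in> C_psi \<psi> b" "\<gamma> \<in> tempered"
  shows "generator \<psi> b (F_exp \<phi>) \<gamma> = L_exp \<phi> \<gamma>"
  unfolding generator_def
proof (rule the_equality)
  show "\<exists>G. (F_exp \<phi>, G) \<in> generator_graph \<psi> b \<and> L_exp \<phi> \<gamma> = G \<gamma>"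
    using generator_graph_F_exp[OF assms(1)] by blast
  show "r = L_exp \<phi> \<gamma>" if "\<exists>G. (F_exp \<phi>, G) \<in> generator_graph \<psi> b \<and> r = G \<gamma>" for r
    using that generator_graph_unique[OF _ assms] by blast
qed

end

section \<open>Calculus on the half-line\<close>

lemma half_line_derivative_subset:
  assumes "(f has_real_derivative D) (at t within {0..})" "S \<subseteq> {0..}"
  shows "(f has_real_derivative D) (at t within S)"
  using assms has_field_derivative_subset by blast

text \<open>Mean value inequality for \<open>f r - r * f' t\<close>, whose derivative is at most
  \<open>C * \<bar>s - t\<bar>\<close> between the two points. The Lipschitz bound is asked only up
  to \<open>max s t\<close>, to fit constants that are uniform on bounded time intervals.\<close>

lemma lipschitz_derivative_remainder:
  fixes f f' :: "real \<Rightarrow> real"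
  assumes st: "0 \<le> s" "0 \<le> t"
    and deriv: "\<And>r. 0 \<le> r \<Longrightarrow> (f has_real_derivative f' r) (at r within {0..})"
    and lip: "\<And>r. 0 \<le> r \<Longrightarrow> r \<le> max s t \<Longrightarrow> \<bar>f' r - f' t\<bar> \<le> C * \<bar>r - t\<bar>"
    and C: "0 \<le> C"
  shows "\<bar>f s - f t - (s - t) * f' t\<bar> \<le> C * (s - t)\<^sup>2"
proof -
  let ?S = "closed_segment s t"
  have S: "0 \<le> r" "r \<le> max s t" "\<bar>r - t\<bar> \<le> \<bar>s - t\<bar>" if "r \<in> ?S" for r
    using that st by (auto simp: closed_segment_eq_real_ivl split: if_splits)
  have "norm ((f s - s * f' t) - (f t - t * f' t)) \<le> (C * \<bar>s - t\<bar>) * norm (s - t)"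
  proof (rule field_differentiable_bound[where S = ?S and f' = "\<lambda>r. f' r - f' t"])
    fix r assume r: "r \<in> ?S"
    have "(f has_real_derivative f' r) (at r within ?S)"
      by (rule half_line_derivative_subset[OF deriv[OF S(1)[OF r]]]) (use S(1) in auto)
    then show "((\<lambda>r. f r - r * f' t) has_real_derivative f' r - f' t) (at r within ?S)"
      by (auto intro!: derivative_eq_intros)
    show "norm (f' r - f' t) \<le> C * \<bar>s - t\<bar>"
      using lip[OF S(1,2)[OF r]] mult_left_mono[OF S(3)[OF r] C] by simp
  qed auto
  then show ?thesis
    by (simp add: power2_eq_square mult.assoc abs_mult_self_eq algebra_simps)
qed

lemma has_real_derivative_quadratic:
  fixes f :: "real \<Rightarrow> real"
  assumes "\<And>s. s \<in> S \<Longrightarrow> \<bar>f s - f t - (s - t) * D\<bar> \<le> C * (s - t)\<^sup>2"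
  shows "(f has_real_derivative D) (at t within S)"
  unfolding has_field_derivative_iff
proof (rule LIM_zero_cancel, rule Lim_null_comparison)
  show "\<forall>\<^sub>F s in at t within S. norm ((f s - f t) / (s - t) - D) \<le> C * \<bar>s - t\<bar>"
    unfolding eventually_at_filter
  proof (intro always_eventually allI impI)
    fix s assume s: "s \<noteq> t" "s \<in> S"
    have "(f s - f t) / (s - t) - D = (f s - f t - (s - t) * D) / (s - t)"
      using s(1) by (simp add: field_simps)
    then have "norm ((f s - f t) / (s - t) - D) = \<bar>f s - f t - (s - t) * D\<bar> / \<bar>s - t\<bar>"
      by simp
    also have "\<dots> \<le> C * \<bar>s - t\<bar>"
    proof -
      have "\<bar>f s - f t - (s - t) * D\<bar> \<le> C * \<bar>s - t\<bar> * \<bar>s - t\<bar>"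
        using assms[OF s(2)] by (simp add: power2_eq_square mult.assoc)
      then show ?thesis
        using s(1) by (subst pos_divide_le_eq) simp_all
    qed
    finally show "norm ((f s - f t) / (s - t) - D) \<le> C * \<bar>s - t\<bar>" .
  qed
  have "((\<lambda>s. C * \<bar>s - t\<bar>) \<longlongrightarrow> C * \<bar>t - t\<bar>) (at t within S)"
    by (intro tendsto_intros)
  then show "((\<lambda>s. C * \<bar>s - t\<bar>) \<longlongrightarrow> 0) (at t within S)" by simp
qed

lemma derivative_nonneg_le:
  fixes f f' :: "real \<Rightarrow> real"
  assumes "0 \<le> t"
    and "\<And>r. 0 \<le> r \<Longrightarrow> (f has_real_derivative f' r) (at r within {0..})"
    and "\<And>r. 0 \<le> r \<Longrightarrow> r \<le> t \<Longrightarrow> 0 \<le> f' r"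
  shows "f 0 \<le> f t"
proof -
  have "\<exists>r\<in>{0..t}. f t - f 0 = f' r * (t - 0)"
  proof (rule mvt_very_simple[OF assms(1)])
    fix r assume r: "0 \<le> r" "r \<le> t"
    have "(f has_real_derivative f' r) (at r within {0..t})"
      using assms(2)[OF r(1)] by (rule half_line_derivative_subset) auto
    then show "(f has_derivative (*) (f' r)) (at r within {0..t})"
      by (simp add: has_field_derivative_def)
  qed
  then obtain r where r: "r \<in> {0..t}" "f t - f 0 = f' r * t" by auto
  then have "0 \<le> f' r * t" using assms(1,3) by simp
  with r(2) show ?thesis by linarith
qed

text \<open>The factor \<open>exp m\<close> is kept because \<open>m\<close> will be a negative
  multiple of the total weight, which supplies the decay.\<close>

lemma abs_exp_diff_le:
  fixes m :: real
  assumes "a \<le> m" "c \<le> m"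
  shows "\<bar>exp a - exp c\<bar> \<le> exp m * \<bar>a - c\<bar>"
proof -
  have "norm (exp a - exp c) \<le> exp m * norm (a - c)"
    by (rule field_differentiable_bound[where S = "{..m}" and f' = exp])
      (use assms in \<open>auto intro!: derivative_eq_intros\<close>)
  then show ?thesis by simp
qed

section \<open>The flow of test functions\<close>

text \<open>An unpacked form of \<open>test_flow\<close>, with a witness \<open>c\<close> that
  \<open>\<phi>\<close> is in \<open>C_psi\<close>. The same \<open>c\<close> enters the lower bound
  on \<open>1 - u t x\<close> at all times.\<close>

locale branching_flow = branching_system +
  fixes \<phi> :: "'a \<Rightarrow>\<^sub>C real" and u u' :: "real \<Rightarrow> ('a \<Rightarrow>\<^sub>C real)" and c :: real
  assumes c_pos: "0 < c" and c_le: "c * \<psi> x \<le> 1 - \<phi> x"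
    and u_0: "u 0 = \<phi>"
    and u_C_psi: "0 \<le> t \<Longrightarrow> u t \<in> C_psi \<psi> b"
    and u_deriv: "0 \<le> t \<Longrightarrow> (u has_vector_derivative u' t) (at t within {0..})"
    and u'_eq: "0 \<le> t \<Longrightarrow> u' t x = - u t x + gen_fun b (u t) x"
begin

section \<open>Weighted Lipschitz estimates along the flow\<close>

lemma u_deriv_at:
  assumes "0 \<le> t"
  shows "((\<lambda>s. u s x) has_real_derivative u' t x) (at t within {0..})"
proof -
  have "bounded_linear (\<lambda>f :: 'a \<Rightarrow>\<^sub>C real. f x)"
  proof (rule bounded_linear_intro[where K = 1])
    show "norm (f x) \<le> norm f * 1" for f :: "'a \<Rightarrow>\<^sub>C real"
      using norm_bounded[of f x] by simp
  qed simp_all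
  from bounded_linear.has_vector_derivative[OF this u_deriv[OF assms]] show ?thesis
    by (simp add: has_real_derivative_iff_has_vector_derivative)
qed

lemma u'_bound:
  assumes "0 \<le> t"
  shows "\<bar>u' t x\<bar> \<le> \<psi> x"
  using gen_fun_bounds[OF C_psi_unit_fun[OF u_C_psi[OF assms]], of x] death_prob_ge[of x]
    C_psi_bounds[OF u_C_psi[OF assms], of x] unfolding u'_eq[OF assms] by linarith

lemma u_lipschitz:
  assumes "0 \<le> s" "0 \<le> t"
  shows "\<bar>u s x - u t x\<bar> \<le> \<bar>s - t\<bar> * \<psi> x"
proof -
  have "norm (u s x - u t x) \<le> \<psi> x * norm (s - t)"
    by (rule field_differentiable_bound[where S = "{0..}"]) (use assms u_deriv_at u'_bound in auto)
  then show ?thesis by (simp add: mult.commute)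
qed

lemma drift_u:
  assumes "0 \<le> t"
  shows "drift (u t) x = u' t x / u t x"
  using C_psi_bounds(3)[OF u_C_psi[OF assms], of x] by (simp add: drift_def u'_eq[OF assms] field_simps)

lemma ln_u_deriv:
  assumes "0 \<le> t"
  shows "((\<lambda>s. ln (u s x)) has_real_derivative drift (u t) x) (at t within {0..})"
  using C_psi_bounds(3)[OF u_C_psi[OF assms], of x] u_deriv_at[OF assms, of x]
  by (auto intro!: derivative_eq_intros simp: drift_u[OF assms])

lemma ln_u_lipschitz:
  assumes "0 \<le> s" "0 \<le> t"
  shows "\<bar>ln (u s x) - ln (u t x)\<bar> \<le> \<bar>s - t\<bar> / psi_gap * \<psi> x"
proof -
  have "norm (ln (u s x) - ln (u t x)) \<le> (1 / psi_gap * \<psi> x) * norm (s - t)"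
    by (rule field_differentiable_bound[where S = "{0..}"])
      (use assms ln_u_deriv drift_bound[OF u_C_psi] in auto)
  then show ?thesis by (simp add: algebra_simps)
qed

text \<open>Lipschitz continuity is needed relative to the weight \<open>\<psi>\<close>, which the supremum norm of
  \<open>u'\<close> does not see; it comes from the bound on the first moment.\<close>

lemma drift_lipschitz:
  obtains C where "0 \<le> C"
    and "\<And>s t x. 0 \<le> s \<Longrightarrow> 0 \<le> t \<Longrightarrow> \<bar>drift (u s) x - drift (u t) x\<bar> \<le> C * \<bar>s - t\<bar> * \<psi> x"
proof -
  obtain K where K: "0 \<le> K"
    "\<And>u w B x. unit_fun u \<Longrightarrow> unit_fun w \<Longrightarrow> 0 \<le> B \<Longrightarrow> (\<And>y. \<bar>u y - w y\<bar> \<le> B * \<psi> y) \<Longrightarrow>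
      \<bar>gen_fun b u x - gen_fun b w x\<bar> \<le> B * K * \<psi> x"
    using gen_fun_diff_le_psi by blast
  \<comment> \<open>The first term pays for the change of the generating function, the second for
    the change of the denominator.\<close>
  define C where "C = K / psi_gap + 1 / psi_gap\<^sup>2"
  show ?thesis
  proof (rule that[of C])
    show "0 \<le> C" using K(1) psi_gap_pos by (simp add: C_def)
    fix s t :: real and x assume st: "0 \<le> s" "0 \<le> t"
    let ?us = "u s x" and ?ut = "u t x" and ?gs = "gen_fun b (u s) x" and ?gt = "gen_fun b (u t) x"
    note bs = C_psi_bounds[OF u_C_psi[OF st(1)], of x] and bt = C_psi_bounds[OF u_C_psi[OF st(2)], of x]
    have g: "\<bar>?gs - ?gt\<bar> \<le> \<bar>s - t\<bar> * K * \<psi> x"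
      using st by (intro K(2) C_psi_unit_fun u_C_psi u_lipschitz) auto
    have gt: "\<bar>?gt\<bar> \<le> 1"
      using gen_fun_bounds[OF C_psi_unit_fun[OF u_C_psi[OF st(2)]], of x] by (simp add: death_prob_def)
        (smt (verit) measure_nonneg)
    \<comment> \<open>Change the numerator first, then the denominator; \<open>u s x\<close> and
      \<open>u t x\<close> are both at least \<open>psi_gap\<close>.\<close>
    have "drift (u s) x - drift (u t) x = (?gs - ?gt) / ?us + ?gt * (?ut - ?us) / (?us * ?ut)"
      using bs(3) bt(3) by (simp add: drift_def field_simps)
    then have "\<bar>drift (u s) x - drift (u t) x\<bar> \<le> \<bar>?gs - ?gt\<bar> / ?us + \<bar>?gt\<bar> * \<bar>?ut - ?us\<bar> / (?us * ?ut)"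
      using bs(3) bt(3) by (simp add: order_trans[OF abs_triangle_ineq] abs_mult)
    also have "\<dots> \<le> (\<bar>s - t\<bar> * K * \<psi> x) / psi_gap + (1 * (\<bar>s - t\<bar> * \<psi> x)) / (psi_gap * psi_gap)"
    proof (rule add_mono)
      show "\<bar>?gs - ?gt\<bar> / ?us \<le> (\<bar>s - t\<bar> * K * \<psi> x) / psi_gap"
        using g bs psi_gap_pos by (intro frac_le) auto
      have "\<bar>?gt\<bar> * \<bar>?ut - ?us\<bar> \<le> 1 * (\<bar>s - t\<bar> * \<psi> x)"
        using gt u_lipschitz[OF st, of x] by (intro mult_mono) (auto simp: abs_minus_commute)
      moreover have "psi_gap * psi_gap \<le> ?us * ?ut"
        using bs bt psi_gap_pos by (intro mult_mono) auto
      ultimately show "\<bar>?gt\<bar> * \<bar>?ut - ?us\<bar> / (?us * ?ut) \<le> (1 * (\<bar>s - t\<bar> * \<psi> x)) / (psi_gap * psi_gap)"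
        using psi_gap_pos psi_nonneg[of x] by (intro frac_le) auto
    qed
    also have "\<dots> = C * \<bar>s - t\<bar> * \<psi> x"
      by (simp add: C_def power2_eq_square algebra_simps)
    finally show "\<bar>drift (u s) x - drift (u t) x\<bar> \<le> C * \<bar>s - t\<bar> * \<psi> x" .
  qed
qed

text \<open>Differentiation under the infinite sum: each term has a quadratic remainder with
  constant \<open>C * \<psi> x\<close>, and these constants sum to \<open>C\<close> times the total
  weight.\<close>

lemma config_sum_ln_u_deriv:
  assumes \<gamma>: "\<gamma> \<in> tempered" and t: "0 \<le> t"
  shows "((\<lambda>s. config_sum \<gamma> (\<lambda>x. ln (u s x))) has_real_derivative config_sum \<gamma> (drift (u t)))
    (at t within {0..})"
proof -
  obtain C where C: "0 \<le> C"
    "\<And>s t x. 0 \<le> s \<Longrightarrow> 0 \<le> t \<Longrightarrow> \<bar>drift (u s) x - drift (u t) x\<bar> \<le> C * \<bar>s - t\<bar> * \<psi> x"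
    using drift_lipschitz by blast
  show ?thesis
  proof (rule has_real_derivative_quadratic)
    fix s :: real assume "s \<in> {0..}"
    then have s: "0 \<le> s" by simp
    let ?l = "\<lambda>s x. ln (u s x)"
    have lb: "\<bar>?l s x - ?l t x\<bar> \<le> \<bar>s - t\<bar> / psi_gap * \<psi> x" for x
      by (rule ln_u_lipschitz[OF s t])
    have db: "\<bar>(s - t) * drift (u t) x\<bar> \<le> \<bar>s - t\<bar> / psi_gap * \<psi> x" for x
      using mult_left_mono[OF drift_bound[OF u_C_psi[OF t], of x], of "\<bar>s - t\<bar>"] by (simp add: abs_mult)
    have "\<bar>?l s x - ?l t x - (s - t) * drift (u t) x\<bar> \<le> (C * \<psi> x) * (s - t)\<^sup>2" for x
    proof (rule lipschitz_derivative_remainder[OF s t ln_u_deriv])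
      show "\<bar>drift (u r) x - drift (u t) x\<bar> \<le> C * \<psi> x * \<bar>r - t\<bar>" if "0 \<le> r" for r
        using C(2)[OF that t, of x] by (simp add: algebra_simps)
    qed (use C(1) psi_nonneg in auto)
    then have "\<bar>?l s x - ?l t x - (s - t) * drift (u t) x\<bar> \<le> (C * (s - t)\<^sup>2) * \<psi> x" for x
      by (simp add: algebra_simps)
    from config_sum_abs_le[OF \<gamma> this]
    have "\<bar>config_sum \<gamma> (?l s) - config_sum \<gamma> (?l t) - (s - t) * config_sum \<gamma> (drift (u t))\<bar>
        \<le> C * (s - t)\<^sup>2 * config_sum \<gamma> \<psi>"
      unfolding config_sum_diff[OF \<gamma> lb db] config_sum_cmult
        config_sum_diff[OF \<gamma> C_psi_ln_bound(2)[OF u_C_psi[OF s]] C_psi_ln_bound(2)[OF u_C_psi[OF t]]] .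
    then show "\<bar>config_sum \<gamma> (?l s) - config_sum \<gamma> (?l t) - (s - t) * config_sum \<gamma> (drift (u t))\<bar>
        \<le> C * config_sum \<gamma> \<psi> * (s - t)\<^sup>2"
      by (simp add: algebra_simps)
  qed
qed

lemma F_exp_u_deriv:
  assumes \<gamma>: "\<gamma> \<in> tempered" and t: "0 \<le> t"
  shows "((\<lambda>s. F_exp (u s) \<gamma>) has_real_derivative L_exp (u t) \<gamma>) (at t within {0..})"
proof (rule has_field_derivative_transform_within[OF _ zero_less_one])
  show "((\<lambda>s. exp (config_sum \<gamma> (\<lambda>x. ln (u s x)))) has_real_derivative L_exp (u t) \<gamma>) (at t within {0..})"
    unfolding L_exp_def F_exp_eq[OF u_C_psi[OF t] \<gamma>]
    using config_sum_ln_u_deriv[OF assms] by (auto intro!: derivative_eq_intros)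
qed (use t F_exp_eq[OF u_C_psi \<gamma>] in auto)

text \<open>The integrating factor \<open>exp t\<close> cancels the linear term of the
  equation.\<close>

lemma one_minus_u_deriv:
  assumes "0 \<le> t"
  shows "((\<lambda>s. exp s * (1 - u s x)) has_real_derivative exp t * (1 - gen_fun b (u t) x))
    (at t within {0..})"
  using u_deriv_at[OF assms, of x]
  by (auto intro!: derivative_eq_intros simp: u'_eq[OF assms] algebra_simps)

text \<open>Since \<open>gen_fun\<close> is at most 1, \<open>exp t * (1 - u t x)\<close> is
  nondecreasing; compare with time 0.\<close>

lemma u_lower:
  assumes t: "0 \<le> t"
  shows "c * exp (- t) * \<psi> x \<le> 1 - u t x"
proof -
  have "exp 0 * (1 - u 0 x) \<le> exp t * (1 - u t x)"
  proof (rule derivative_nonneg_le[OF t one_minus_u_deriv])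
    show "0 \<le> exp r * (1 - gen_fun b (u r) x)" if "0 \<le> r" for r
      using gen_fun_bounds(2)[OF C_psi_unit_fun[OF u_C_psi[OF that]]] by simp
  qed
  then have "c * \<psi> x \<le> exp t * (1 - u t x)"
    using c_le[of x] by (simp add: u_0)
  then have "exp (- t) * (c * \<psi> x) \<le> exp (- t) * (exp t * (1 - u t x))"
    by (rule mult_left_mono) simp
  moreover have "exp (- t) * (exp t * (1 - u t x)) = 1 - u t x"
    by (simp add: exp_minus)
  ultimately show ?thesis by (simp only: mult_ac)
qed

text \<open>The constant is uniform in the configuration but depends on \<open>T\<close>. A
  difference splits into a change of \<open>drift\<close>, which costs one power of the total
  weight, and a change of \<open>F_exp\<close>, which costs two.\<close>

lemma L_exp_lipschitz:
  obtains C where "0 \<le> C"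
    and "\<And>\<gamma> s t. \<gamma> \<in> tempered \<Longrightarrow> 0 \<le> s \<Longrightarrow> s \<le> T \<Longrightarrow> 0 \<le> t \<Longrightarrow> t \<le> T \<Longrightarrow>
      \<bar>L_exp (u s) \<gamma> - L_exp (u t) \<gamma>\<bar> \<le> C * \<bar>s - t\<bar>"
proof -
  obtain K where K: "0 \<le> K"
    "\<And>s t x. 0 \<le> s \<Longrightarrow> 0 \<le> t \<Longrightarrow> \<bar>drift (u s) x - drift (u t) x\<bar> \<le> K * \<bar>s - t\<bar> * \<psi> x"
    using drift_lipschitz by blast
  \<comment> \<open>The smallest constant that \<open>u_lower\<close> yields up to time
    \<open>T\<close>.\<close>
  define a where "a = c * exp (- T)"
  have a: "0 < a" using c_pos by (simp add: a_def)
  \<comment> \<open>One power of the weight costs \<open>1 / a\<close>; for two powers the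
    exponential is split into equal halves, each costing \<open>1 / (a / 2)\<close>.\<close>
  define C where "C = K * (1 / a) + (1 / psi_gap\<^sup>2) * (1 / (a / 2))\<^sup>2"
  show ?thesis
  proof (rule that[of C])
    show "0 \<le> C" using K(1) a by (simp add: C_def)
    fix \<gamma> s t assume \<gamma>: "\<gamma> \<in> tempered" and s: "0 \<le> s" "s \<le> T" and t: "0 \<le> t" "t \<le> T"
    let ?P = "config_sum \<gamma> \<psi>" and ?W = "\<lambda>s. config_sum \<gamma> (\<lambda>x. ln (u s x))"
      and ?D = "\<lambda>s. config_sum \<gamma> (drift (u s))"
    have P: "0 \<le> ?P" by (rule config_sum_psi_nonneg)
    have W: "?W r \<le> - (a * ?P)" if r: "0 \<le> r" "r \<le> T" for r
    proof (rule config_sum_ln_le[OF u_C_psi[OF r(1)] _ \<gamma>])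
      fix x
      have "a * \<psi> x \<le> c * exp (- r) * \<psi> x"
        using r c_pos psi_nonneg[of x] unfolding a_def by (intro mult_right_mono mult_left_mono) auto
      also have "\<dots> \<le> 1 - u r x" by (rule u_lower[OF r(1)])
      finally show "a * \<psi> x \<le> 1 - u r x" .
    qed
    have D_diff: "\<bar>?D s - ?D t\<bar> \<le> K * \<bar>s - t\<bar> * ?P"
      using config_sum_abs_le[OF \<gamma> K(2)[OF s(1) t(1)]]
        config_sum_diff[OF \<gamma> drift_bound[OF u_C_psi[OF s(1)]] drift_bound[OF u_C_psi[OF t(1)]]] by simp
    have D: "\<bar>?D t\<bar> \<le> 1 / psi_gap * ?P"
      by (rule config_sum_abs_le[OF \<gamma> drift_bound[OF u_C_psi[OF t(1)]]])
    have W_diff: "\<bar>?W s - ?W t\<bar> \<le> \<bar>s - t\<bar> / psi_gap * ?P"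
      using config_sum_abs_le[OF \<gamma> ln_u_lipschitz[OF s(1) t(1)]]
        config_sum_diff[OF \<gamma> C_psi_ln_bound(2)[OF u_C_psi[OF s(1)]] C_psi_ln_bound(2)[OF u_C_psi[OF t(1)]]]
      by simp
    have exp_half: "exp (- (a * ?P)) * (?P * ?P) = (?P * exp (- (a / 2 * ?P)))\<^sup>2"
      by (simp add: power2_eq_square exp_add[symmetric] algebra_simps flip: mult.assoc)
    have "L_exp (u s) \<gamma> - L_exp (u t) \<gamma> = exp (?W s) * (?D s - ?D t) + (exp (?W s) - exp (?W t)) * ?D t"
      unfolding L_exp_def F_exp_eq[OF u_C_psi[OF s(1)] \<gamma>] F_exp_eq[OF u_C_psi[OF t(1)] \<gamma>]
      by (simp add: algebra_simps)
    then have "\<bar>L_exp (u s) \<gamma> - L_exp (u t) \<gamma>\<bar> \<le>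
        exp (?W s) * \<bar>?D s - ?D t\<bar> + \<bar>exp (?W s) - exp (?W t)\<bar> * \<bar>?D t\<bar>"
      using abs_triangle_ineq[of "exp (?W s) * (?D s - ?D t)" "(exp (?W s) - exp (?W t)) * ?D t"]
      by (simp add: abs_mult)
    also have "\<dots> \<le> exp (- (a * ?P)) * (K * \<bar>s - t\<bar> * ?P) +
        (exp (- (a * ?P)) * (\<bar>s - t\<bar> / psi_gap * ?P)) * (1 / psi_gap * ?P)"
    proof (intro add_mono mult_mono D_diff D)
      show "exp (?W s) \<le> exp (- (a * ?P))" using W[OF s] by simp
      have "\<bar>exp (?W s) - exp (?W t)\<bar> \<le> exp (- (a * ?P)) * \<bar>?W s - ?W t\<bar>"
        by (rule abs_exp_diff_le[OF W[OF s] W[OF t]])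
      also have "\<dots> \<le> exp (- (a * ?P)) * (\<bar>s - t\<bar> / psi_gap * ?P)"
        by (intro mult_left_mono W_diff) simp
      finally show "\<bar>exp (?W s) - exp (?W t)\<bar> \<le> exp (- (a * ?P)) * (\<bar>s - t\<bar> / psi_gap * ?P)" .
    qed (use psi_gap_pos P in simp_all)
    also have "\<dots> = \<bar>s - t\<bar> * (K * (?P * exp (- (a * ?P))) +
        (1 / psi_gap\<^sup>2) * (exp (- (a * ?P)) * (?P * ?P)))"
      by (simp add: power2_eq_square algebra_simps)
    also have "\<dots> \<le> \<bar>s - t\<bar> * C"
      unfolding exp_half C_def
    proof (intro mult_left_mono add_mono power_mono)
      show "?P * exp (- (a * ?P)) \<le> 1 / a" by (rule mult_exp_neg_le[OF a P])
      show "?P * exp (- (a / 2 * ?P)) \<le> 1 / (a / 2)" using a by (intro mult_exp_neg_le[OF _ P]) simp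
    qed (use K(1) P in simp_all)
    finally show "\<bar>L_exp (u s) \<gamma> - L_exp (u t) \<gamma>\<bar> \<le> C * \<bar>s - t\<bar>"
      by (simp add: mult.commute)
  qed
qed

section \<open>Norm differentiability and the classical solution\<close>

lemma sup_norm_tendsto_zero_at:
  assumes "0 \<le> C" and "\<And>s \<gamma>. 0 \<le> s \<Longrightarrow> s \<le> t + 1 \<Longrightarrow> s \<noteq> t \<Longrightarrow> \<gamma> \<in> tempered \<Longrightarrow> \<bar>F s \<gamma>\<bar> \<le> C * \<bar>s - t\<bar>"
  shows "((\<lambda>s. sup_norm tempered_top (F s)) \<longlongrightarrow> 0) (at t within {0..})"
proof (rule sup_norm_tendsto_zero[OF topspace_tempered_nonempty])
  show "\<forall>\<^sub>F s in at t within {0..}. \<forall>\<gamma>\<in>topspace tempered_top. \<bar>F s \<gamma>\<bar> \<le> C * \<bar>s - t\<bar>"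
    unfolding eventually_at by (rule exI[of _ 1]) (use assms(2) in \<open>auto simp: dist_real_def\<close>)
  have "((\<lambda>s. C * \<bar>s - t\<bar>) \<longlongrightarrow> C * \<bar>t - t\<bar>) (at t within {0..})"
    by (intro tendsto_intros)
  then show "((\<lambda>s. C * \<bar>s - t\<bar>) \<longlongrightarrow> 0) (at t within {0..})" by simp
qed

lemma F_exp_norm_derivative:
  assumes t: "0 \<le> t"
  shows "has_norm_derivative tempered_top (\<lambda>t. F_exp (u t)) (L_exp (u t)) t"
proof -
  obtain C where C: "0 \<le> C"
    "\<And>\<gamma> s r. \<gamma> \<in> tempered \<Longrightarrow> 0 \<le> s \<Longrightarrow> s \<le> t + 1 \<Longrightarrow> 0 \<le> r \<Longrightarrow> r \<le> t + 1 \<Longrightarrow>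
      \<bar>L_exp (u s) \<gamma> - L_exp (u r) \<gamma>\<bar> \<le> C * \<bar>s - r\<bar>"
    \<comment> \<open>The horizon \<open>t + 1\<close> leaves room on both sides of
      \<open>t\<close>; only times close to \<open>t\<close> matter.\<close>
    using L_exp_lipschitz[of "t + 1"] by blast
  show ?thesis
    unfolding has_norm_derivative_def
  proof (rule sup_norm_tendsto_zero_at[OF C(1)])
    fix s \<gamma> assume s: "0 \<le> s" "s \<le> t + 1" "s \<noteq> t" and \<gamma>: "\<gamma> \<in> tempered"
    let ?F = "\<lambda>s. F_exp (u s) \<gamma>" and ?L = "L_exp (u t) \<gamma>"
    have "\<bar>?F s - ?F t - (s - t) * ?L\<bar> \<le> C * (s - t)\<^sup>2"
      using s t by (intro lipschitz_derivative_remainder[OF _ _ F_exp_u_deriv[OF \<gamma>]] C \<gamma>) auto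
    also have "\<dots> = C * \<bar>s - t\<bar> * \<bar>s - t\<bar>" by (simp add: power2_eq_square)
    finally have "\<bar>?F s - ?F t - (s - t) * ?L\<bar> / \<bar>s - t\<bar> \<le> C * \<bar>s - t\<bar>"
      using s(3) by (simp add: pos_divide_le_eq)
    moreover have "(?F s - ?F t) / (s - t) - ?L = (?F s - ?F t - (s - t) * ?L) / (s - t)"
      using s(3) by (simp add: field_simps)
    ultimately show "\<bar>(?F s - ?F t) / (s - t) - ?L\<bar> \<le> C * \<bar>s - t\<bar>" by simp
  qed
qed

lemma F_exp_classical_solution: "classical_solution \<psi> b (F_exp \<phi>) (\<lambda>t. F_exp (u t))"
  unfolding classical_solution_def
proof (intro conjI exI[of _ "\<lambda>t. L_exp (u t)"] allI impI ballI)
  fix t :: real assume t: "0 \<le> t"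
  show "F_exp (u t) \<in> generator_domain \<psi> b"
    unfolding generator_domain_def using generator_graph_F_exp[OF u_C_psi[OF t]] by blast
  show "L_exp (u t) \<in> Cb tempered_top" by (rule L_exp_Cb[OF u_C_psi[OF t]])
  show "has_norm_derivative tempered_top (\<lambda>t. F_exp (u t)) (L_exp (u t)) t"
    by (rule F_exp_norm_derivative[OF t])
  obtain C where C: "0 \<le> C"
    "\<And>\<gamma> s r. \<gamma> \<in> tempered \<Longrightarrow> 0 \<le> s \<Longrightarrow> s \<le> t + 1 \<Longrightarrow> 0 \<le> r \<Longrightarrow> r \<le> t + 1 \<Longrightarrow>
      \<bar>L_exp (u s) \<gamma> - L_exp (u r) \<gamma>\<bar> \<le> C * \<bar>s - r\<bar>"
    using L_exp_lipschitz[of "t + 1"] by blast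
  show "((\<lambda>s. sup_norm tempered_top (\<lambda>\<gamma>. L_exp (u s) \<gamma> - L_exp (u t) \<gamma>)) \<longlongrightarrow> 0) (at t within {0..})"
    using t by (intro sup_norm_tendsto_zero_at[OF C(1)] C(2)) auto
  show "L_exp (u t) \<gamma> = generator \<psi> b (F_exp (u t)) \<gamma>" if "\<gamma> \<in> tempered" for \<gamma>
    using generator_F_exp[OF u_C_psi[OF t] that] by simp
qed (simp add: u_0)

section \<open>Subcritical branching\<close>

text \<open>Gronwall without an integral: at a maximiser \<open>t\<^sub>0\<close> of \<open>e\<^bsup>(1 - n) t\<^esup> \<parallel>1 - u\<^sub>t\<parallel>\<close> on \<open>[0, T]\<close>,
  integrating \<open>(e\<^bsup>t\<^esup> (1 - u\<^sub>t))' \<le> n A e\<^bsup>n t\<^esup>\<close> over \<open>[0, t\<^sub>0]\<close> bounds the maximal value \<open>A\<close> by 1.\<close>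

lemma one_minus_u_decay:
  defines "n \<equiv> enn2real (max_mean_offspring b)"
  assumes T: "0 \<le> T"
  shows "1 - u T x \<le> exp (- ((1 - n) * T))"
proof -
  define v where "v t = const_bcontfun 1 - u t" for t
  have v: "v t x = 1 - u t x" for t x by (simp add: v_def)
  have n: "0 \<le> n" by (simp add: n_def)
  have "continuous_on {0..T} u"
    by (intro continuous_on_vector_derivative[where f' = u']
        has_vector_derivative_within_subset[OF u_deriv]) auto
  then have cont: "continuous_on {0..T} (\<lambda>t. exp ((1 - n) * t) * norm (v t))"
    unfolding v_def by (intro continuous_intros)
  have ex: "\<exists>t\<in>{0..T}. \<forall>r\<in>{0..T}. exp ((1 - n) * r) * norm (v r) \<le> exp ((1 - n) * t) * norm (v t)"
    by (rule continuous_attains_sup[OF _ _ cont]) (use T in auto)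
  then obtain t where t: "0 \<le> t" "t \<le> T"
    and max: "\<And>r. 0 \<le> r \<Longrightarrow> r \<le> T \<Longrightarrow> exp ((1 - n) * r) * norm (v r) \<le> exp ((1 - n) * t) * norm (v t)"
    by auto
  define A where "A = exp ((1 - n) * t) * norm (v t)"
  have v_le: "norm (v r) \<le> A * exp (- ((1 - n) * r))" if "0 \<le> r" "r \<le> T" for r
  proof -
    have "norm (v r) = exp (- ((1 - n) * r)) * (exp ((1 - n) * r) * norm (v r))"
      by (simp add: exp_minus)
    also have "\<dots> \<le> exp (- ((1 - n) * r)) * A"
      unfolding A_def by (intro mult_left_mono max that) simp
    finally show ?thesis by (simp add: mult.commute)
  qed
  \<comment> \<open>\<open>A * exp (n * t) - A\<close> is the integral of the bound on the
    derivative, and the remaining 1 bounds the initial value \<open>1 - u 0 x\<close>.\<close>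
  have "norm (v t) \<le> exp (- t) * (A * exp (n * t) + (1 - A))"
  proof (rule norm_bound)
    fix x
    have "A * exp (n * 0) - exp 0 * (1 - u 0 x) \<le> A * exp (n * t) - exp t * (1 - u t x)"
    proof (rule derivative_nonneg_le[OF t(1)])
      fix r :: real assume r: "0 \<le> r"
      show "((\<lambda>r. A * exp (n * r) - exp r * (1 - u r x)) has_real_derivative
          A * (n * exp (n * r)) - exp r * (1 - gen_fun b (u r) x)) (at r within {0..})"
        by (rule derivative_eq_intros one_minus_u_deriv[OF r] refl)+ simp
      assume "r \<le> t"
      then have rT: "r \<le> T" using t(2) by simp
      have "\<bar>gen_fun b (\<lambda>x. 1) x - gen_fun b (u r) x\<bar> \<le> n * norm (v r)"
        unfolding n_def
      proof (rule gen_fun_diff_le_const[OF unit_fun_one C_psi_unit_fun[OF u_C_psi[OF r]]])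
        show "\<bar>1 - u r y\<bar> \<le> norm (v r)" for y
          using norm_bounded[of "v r" y] by (simp add: v)
      qed simp
      then have "1 - gen_fun b (u r) x \<le> n * norm (v r)"
        by (simp add: gen_fun_one)
      also have "\<dots> \<le> n * (A * exp (- ((1 - n) * r)))"
        by (intro mult_left_mono v_le r rT n)
      finally have "exp r * (1 - gen_fun b (u r) x) \<le> exp r * (n * (A * exp (- ((1 - n) * r))))"
        by (rule mult_left_mono) simp
      also have "\<dots> = A * (n * (exp r * exp (- ((1 - n) * r))))" by simp
      also have "exp r * exp (- ((1 - n) * r)) = exp (n * r)"
        by (simp add: exp_add[symmetric] algebra_simps)
      finally show "0 \<le> A * (n * exp (n * r)) - exp r * (1 - gen_fun b (u r) x)" by simp
    qed
    then have "exp t * (1 - u t x) \<le> A * exp (n * t) + (1 - A)"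
      using C_psi_bounds(3)[OF u_C_psi[of 0], of x] by simp
    from mult_left_mono[OF this, of "exp (- t)"]
    have "1 - u t x \<le> exp (- t) * (A * exp (n * t) + (1 - A))"
      by (simp add: mult.assoc[symmetric] exp_minus)
    then show "norm (v t x) \<le> exp (- t) * (A * exp (n * t) + (1 - A))"
      using C_psi_bounds(4)[OF u_C_psi[OF t(1)], of x] by (simp add: v)
  qed
  \<comment> \<open>At the maximiser the left side becomes \<open>A\<close> itself, and after
    cancellation only the sign of \<open>1 - A\<close> remains.\<close>
  from mult_left_mono[OF this, of "exp ((1 - n) * t)"]
  have "A \<le> exp ((1 - n) * t) * exp (- t) * (A * exp (n * t) + (1 - A))"
    by (simp add: A_def mult.assoc)
  also have "exp ((1 - n) * t) * exp (- t) = exp (- (n * t))"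
    by (simp add: exp_add[symmetric] algebra_simps)
  also have "\<dots> * (A * exp (n * t) + (1 - A)) = A + exp (- (n * t)) * (1 - A)"
    by (simp add: exp_minus field_simps)
  finally have "0 \<le> exp (- (n * t)) * (1 - A)" by simp
  then have "A \<le> 1" by (simp add: zero_le_mult_iff)
  have "1 - u T x \<le> norm (v T)"
    using norm_bounded[of "v T" x] by (simp add: v)
  also have "\<dots> \<le> A * exp (- ((1 - n) * T))"
    using T by (intro v_le) auto
  also have "\<dots> \<le> exp (- ((1 - n) * T))"
    using \<open>A \<le> 1\<close> by simp
  finally show ?thesis .
qed

text \<open>On the finite set \<open>A\<close> the uniform bound \<open>e\<close> is used, off
  \<open>A\<close> the weight \<open>\<psi>\<close>. Up to \<open>psi_gap\<close>, the right side is
  the tail of the total weight plus \<open>e\<close> times the number of particles in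
  \<open>A\<close>.\<close>

lemma config_sum_ln_u_split:
  assumes \<gamma>: "\<gamma> \<in> tempered" and "finite A" and t: "0 \<le> t"
    and e: "\<And>x. 1 - u t x \<le> e"
  shows "\<bar>config_sum \<gamma> (\<lambda>x. ln (u t x))\<bar> \<le>
    (config_sum \<gamma> \<psi> - (\<Sum>x\<in>A. real (\<gamma> x) * \<psi> x) + e * (\<Sum>x\<in>A. real (\<gamma> x))) / psi_gap"
proof -
  let ?l = "\<lambda>x. ln (u t x)"
  note bounds = C_psi_bounds[OF u_C_psi[OF t]]
  have lb: "\<bar>- ?l x\<bar> \<le> 1 / psi_gap * \<psi> x" for x
    using C_psi_ln_bound(2)[OF u_C_psi[OF t], of x] by simp
  \<comment> \<open>This correction, supported on \<open>A\<close>, turns \<open>\<psi> x\<close>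
    into \<open>e\<close> there.\<close>
  have "((\<lambda>x. if x \<in> A then real (\<gamma> x) * (e - \<psi> x) else 0) has_sum
      (\<Sum>x\<in>A. real (\<gamma> x) * (e - \<psi> x))) UNIV"
    using has_sum_finite[OF \<open>finite A\<close>]
    by (subst has_sum_cong_neutral[where T = A and g = "\<lambda>x. real (\<gamma> x) * (e - \<psi> x)"]) auto
  from has_sum_cmult_right[OF has_sum_add[OF has_sum_config_sum[OF \<gamma> psi_self_bound] this], of "1 / psi_gap"]
  have "((\<lambda>x. 1 / psi_gap * (real (\<gamma> x) * \<psi> x + (if x \<in> A then real (\<gamma> x) * (e - \<psi> x) else 0))) has_sum
      1 / psi_gap * (config_sum \<gamma> \<psi> + (\<Sum>x\<in>A. real (\<gamma> x) * (e - \<psi> x)))) UNIV" .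
  moreover have "real (\<gamma> x) * - ?l x \<le>
      1 / psi_gap * (real (\<gamma> x) * \<psi> x + (if x \<in> A then real (\<gamma> x) * (e - \<psi> x) else 0))" for x
  proof -
    have "- ?l x \<le> (if x \<in> A then e else \<psi> x) / psi_gap"
      using C_psi_ln_bound(1)[OF u_C_psi[OF t], of x] bounds(1)[of x] e[of x] psi_gap_pos
      by (auto simp: abs_le_iff pos_le_divide_eq)
    from mult_left_mono[OF this, of "real (\<gamma> x)"] show ?thesis
      by (auto simp: algebra_simps add_divide_distrib diff_divide_distrib)
  qed
  ultimately have "config_sum \<gamma> (\<lambda>x. - ?l x) \<le> 1 / psi_gap * (config_sum \<gamma> \<psi> + (\<Sum>x\<in>A. real (\<gamma> x) * (e - \<psi> x)))"
    by (intro has_sum_mono[OF has_sum_config_sum[OF \<gamma> lb]]) auto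
  moreover have "config_sum \<gamma> (\<lambda>x. - ?l x) = - config_sum \<gamma> ?l"
    using config_sum_cmult[of \<gamma> "-1" ?l] by simp
  moreover have "config_sum \<gamma> ?l \<le> 0"
    using config_sum_ln_le[OF u_C_psi[OF t], of 0] bounds(4) \<gamma> by simp
  moreover have "(\<Sum>x\<in>A. real (\<gamma> x) * (e - \<psi> x)) =
      e * (\<Sum>x\<in>A. real (\<gamma> x)) - (\<Sum>x\<in>A. real (\<gamma> x) * \<psi> x)"
    by (simp add: right_diff_distrib sum_subtractf sum_distrib_left mult.commute)
  ultimately show ?thesis
    by (simp add: add_diff_eq diff_add_eq)
qed

lemma F_exp_tendsto_one:
  assumes sub: "max_mean_offspring b < 1" and \<gamma>: "\<gamma> \<in> tempered"
  shows "((\<lambda>t. F_exp (u t) \<gamma>) \<longlongrightarrow> 1) at_top"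
proof -
  define n where "n = enn2real (max_mean_offspring b)"
  have "max_mean_offspring b = ennreal n"
    unfolding n_def using offspring_finite by simp
  with sub have n: "n < 1" by (simp add: ennreal_less_one_iff)
  have decay: "((\<lambda>t. exp (- ((1 - n) * t)) * r) \<longlongrightarrow> 0) at_top" for r :: real
  proof (rule tendsto_mult_left_zero)
    have "filterlim (\<lambda>t. (1 - n) * t) at_top at_top"
      using n by (intro filterlim_tendsto_pos_mult_at_top[OF tendsto_const _ filterlim_ident]) simp
    then show "((\<lambda>t. exp (- ((1 - n) * t))) \<longlongrightarrow> 0) at_top"
      by (intro filterlim_compose[OF exp_at_bot] filterlim_uminus_at_top[THEN iffD1])
  qed
  have W: "((\<lambda>t. config_sum \<gamma> (\<lambda>x. ln (u t x))) \<longlongrightarrow> 0) at_top"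
  proof (rule tendstoI)
    fix \<epsilon> :: real assume "0 < \<epsilon>"
    \<comment> \<open>Half for the tail, half for the particles in \<open>A\<close>;
      \<open>psi_gap\<close> offsets the division in \<open>config_sum_ln_u_split\<close>.\<close>
    then have \<epsilon>: "0 < \<epsilon> * psi_gap / 2" using psi_gap_pos by simp
    have "((\<lambda>A. \<Sum>x\<in>A. real (\<gamma> x) * \<psi> x) \<longlongrightarrow> config_sum \<gamma> \<psi>) (finite_subsets_at_top UNIV)"
      using has_sum_config_sum[OF \<gamma> psi_self_bound] by (simp add: has_sum_def)
    from tendstoD[OF this \<epsilon>] obtain A where A: "finite A"
      "dist (\<Sum>x\<in>A. real (\<gamma> x) * \<psi> x) (config_sum \<gamma> \<psi>) < \<epsilon> * psi_gap / 2"
      by (auto simp: eventually_finite_subsets_at_top)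
    \<comment> \<open>With \<open>A\<close> fixed before \<open>t\<close>, its number of particles
      is a constant factor.\<close>
    have "\<forall>\<^sub>F t in at_top. exp (- ((1 - n) * t)) * (\<Sum>x\<in>A. real (\<gamma> x)) < \<epsilon> * psi_gap / 2"
      by (rule order_tendstoD(2)[OF decay \<epsilon>])
    then show "\<forall>\<^sub>F t in at_top. dist (config_sum \<gamma> (\<lambda>x. ln (u t x))) 0 < \<epsilon>"
      using eventually_ge_at_top[of 0]
    proof eventually_elim
      case (elim t)
      have "\<bar>config_sum \<gamma> (\<lambda>x. ln (u t x))\<bar> \<le>
        (config_sum \<gamma> \<psi> - (\<Sum>x\<in>A. real (\<gamma> x) * \<psi> x) + exp (- ((1 - n) * t)) * (\<Sum>x\<in>A. real (\<gamma> x))) / psi_gap"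
        using one_minus_u_decay[OF elim(2)] by (intro config_sum_ln_u_split \<gamma> A elim) (simp add: n_def)
      also have "\<dots> < \<epsilon>"
      proof -
        have "config_sum \<gamma> \<psi> - (\<Sum>x\<in>A. real (\<gamma> x) * \<psi> x) < \<epsilon> * psi_gap / 2"
          using A(2) unfolding dist_real_def by linarith
        with elim(1) have "config_sum \<gamma> \<psi> - (\<Sum>x\<in>A. real (\<gamma> x) * \<psi> x) +
            exp (- ((1 - n) * t)) * (\<Sum>x\<in>A. real (\<gamma> x)) < \<epsilon> * psi_gap" by linarith
        then show ?thesis using psi_gap_pos by (simp only: pos_divide_less_eq)
      qed
      finally show ?case by simp
    qed
  qed
  have "((\<lambda>t. exp (config_sum \<gamma> (\<lambda>x. ln (u t x)))) \<longlongrightarrow> 1) at_top"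
    using tendsto_exp[OF W] by simp
  moreover have "\<forall>\<^sub>F t in at_top. exp (config_sum \<gamma> (\<lambda>x. ln (u t x))) = F_exp (u t) \<gamma>"
    using eventually_ge_at_top[of 0] by eventually_elim (simp add: F_exp_eq u_C_psi \<gamma>)
  ultimately show ?thesis by (rule Lim_transform_eventually)
qed

end

theorem lemma3p10:
  fixes \<psi> :: "'a::polish_space \<Rightarrow> real"
    and b :: "'a \<Rightarrow> 'a config measure"
    and \<beta> :: "'a \<Rightarrow> 'a measure"
    and \<phi> :: "'a \<Rightarrow>\<^sub>C real"
    and \<phi>\<^sub>t :: "real \<Rightarrow> ('a \<Rightarrow>\<^sub>C real)"
  assumes "branching_system \<psi> b \<beta>"
    and "\<phi> \<in> C_psi \<psi> b"
    and "test_flow \<psi> b \<phi> \<phi>\<^sub>t"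
  shows "classical_solution \<psi> b (F_exp \<phi>) (\<lambda>t. F_exp (\<phi>\<^sub>t t)) \<and>
    (max_mean_offspring b < 1 \<longrightarrow>
      (\<forall>\<gamma>\<in>tempered_configs \<psi>. ((\<lambda>t. F_exp (\<phi>\<^sub>t t) \<gamma>) \<longlongrightarrow> 1) at_top))"
proof -
  obtain c where "c > 0" "\<And>x. c * \<psi> x \<le> 1 - \<phi> x"
    using assms(2) by (auto simp: C_psi_def)
  moreover obtain u' where "\<And>t. 0 \<le> t \<Longrightarrow> (\<phi>\<^sub>t has_vector_derivative u' t) (at t within {0..})"
    "\<And>t x. 0 \<le> t \<Longrightarrow> u' t x = - \<phi>\<^sub>t t x + gen_fun b (\<phi>\<^sub>t t) x"
    using assms(3) by (auto simp: test_flow_def)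
  moreover have "\<phi>\<^sub>t 0 = \<phi>" "\<And>t. 0 \<le> t \<Longrightarrow> \<phi>\<^sub>t t \<in> C_psi \<psi> b"
    using assms(3) by (auto simp: test_flow_def)
  ultimately interpret branching_flow \<psi> b \<beta> \<phi> \<phi>\<^sub>t u' c
    by (intro branching_flow.intro assms(1) branching_flow_axioms.intro)
  show ?thesis
    using F_exp_classical_solution F_exp_tendsto_one by blast
qed

end
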